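(* Let $G = \langle x, y, t \mid x^y = x^2,\ x^t = y\rangle$ be the Baumslag-Gersten group. Then the outer automorphism group $\mathrm{Out}(G)$ is isomorphic to the group of dyadic rationals $\langle \tfrac12, \tfrac14, \tfrac18, \dots\rangle$, i.e. the subgroup of $(\mathbb{Q}, +)$ generated by $\{\tfrac{1}{2^i} : i \ge 1\}$; moreover, this group is not finitely generated.
   Context: Notation: $a^b = b^{-1} a b$. $\mathrm{Out}(G) = \mathrm{Aut}(G)/\mathrm{Inn}(G)$. *)

theory Defs
  imports "HOL-Algebra.Algebra"
begin

section \<open>Free groups and group presentations\<close>

text \<open>
  A letter \<open>(a, True)\<close> stands for the generator \<open>a\<close>, and \<open>(a, False)\<close> for its formal inverse.
  The generating set is the whole type \<open>'a\<close>.
\<close>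

type_synonym 'a word = "('a \<times> bool) list"

inductive free_eq :: "'a word \<Rightarrow> 'a word \<Rightarrow> bool" where
  cancel: "free_eq (u @ (a, e) # (a, \<not> e) # v) (u @ v)"
| refl: "free_eq u u"
| sym: "free_eq u v \<Longrightarrow> free_eq v u"
| trans: "free_eq u v \<Longrightarrow> free_eq v w \<Longrightarrow> free_eq u w"

lemma equivp_free_eq: "equivp free_eq"
  by (intro equivpI reflpI sympI transpI)
     (blast intro: free_eq.refl free_eq.sym free_eq.trans)+

quotient_type 'a free = "'a word" / free_eq
  by (rule equivp_free_eq)

lemma free_eq_append_left: "free_eq u v \<Longrightarrow> free_eq (w @ u) (w @ v)"
proof (induction rule: free_eq.induct)
  case (cancel u a e v)
  then show ?case using free_eq.cancel[of "w @ u" a e v] by simp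
qed (blast intro: free_eq.refl free_eq.sym free_eq.trans)+

lemma free_eq_append_right: "free_eq u v \<Longrightarrow> free_eq (u @ w) (v @ w)"
proof (induction rule: free_eq.induct)
  case (cancel u a e v)
  then show ?case using free_eq.cancel[of u a e "v @ w"] by simp
qed (blast intro: free_eq.refl free_eq.sym free_eq.trans)+

lift_definition free_mult :: "'a free \<Rightarrow> 'a free \<Rightarrow> 'a free" is append
  by (blast intro: free_eq_append_left free_eq_append_right free_eq.trans)

lift_definition free_one :: "'a free" is "[]" .

lift_definition free_gen :: "'a \<Rightarrow> 'a free" is "\<lambda>a. [(a, True)]" .

definition free_group :: "'a free monoid" where
  "free_group = \<lparr>carrier = UNIV, monoid.mult = free_mult, one = free_one\<rparr>"

definition conj_by :: "('a, 'b) monoid_scheme \<Rightarrow> 'a \<Rightarrow> 'a \<Rightarrow> 'a" where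
  "conj_by G a b = inv\<^bsub>G\<^esub> b \<otimes>\<^bsub>G\<^esub> a \<otimes>\<^bsub>G\<^esub> b"

definition normal_closure :: "('a, 'b) monoid_scheme \<Rightarrow> 'a set \<Rightarrow> 'a set" where
  "normal_closure G R = \<Inter> {N. N \<lhd> G \<and> R \<subseteq> N}"

text \<open>A pair \<open>(u, v)\<close> stands for the defining relation \<open>u = v\<close>.\<close>

definition presented_group :: "('a free \<times> 'a free) set \<Rightarrow> 'a free set monoid" where
  "presented_group rels =
     free_group Mod
       normal_closure free_group
         {u \<otimes>\<^bsub>free_group\<^esub> inv\<^bsub>free_group\<^esub> v | u v. (u, v) \<in> rels}"


section \<open>The Baumslag-Gersten group\<close>

datatype bg_gen = GX | GY | GT

definition baumslag_gersten :: "bg_gen free set monoid" where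
  "baumslag_gersten = presented_group
     {(conj_by free_group (free_gen GX) (free_gen GY), free_gen GX [^]\<^bsub>free_group\<^esub> (2::nat)),
      (conj_by free_group (free_gen GX) (free_gen GT), free_gen GY)}"


section \<open>Outer automorphisms, dyadic rationals, finite generation\<close>

definition Inn :: "('a, 'b) monoid_scheme \<Rightarrow> ('a \<Rightarrow> 'a) set" where
  "Inn G = {\<lambda>a\<in>carrier G. conj_by G a g | g. g \<in> carrier G}"

definition Out :: "('a, 'b) monoid_scheme \<Rightarrow> ('a \<Rightarrow> 'a) set monoid" where
  "Out G = AutoGroup G Mod Inn G"

definition rat_group :: "rat monoid" where
  "rat_group = \<lparr>carrier = UNIV, monoid.mult = (+), one = 0\<rparr>"

definition dyadic_group :: "rat monoid" where
  "dyadic_group = subgroup_generated rat_group {1 / 2 ^ i | i :: nat. i \<ge> 1}"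

definition finitely_generated :: "('a, 'b) monoid_scheme \<Rightarrow> bool" where
  "finitely_generated G \<longleftrightarrow> (\<exists>S. finite S \<and> S \<subseteq> carrier G \<and> generate G S = carrier G)"


section \<open>Well-definedness\<close>

lemma free_eq_inverse_left: "free_eq (rev (map (apsnd Not) u) @ u) []"
proof (induction u)
  case (Cons p u)
  obtain a e where p: "p = (a, e)" by (cases p)
  have "free_eq (rev (map (apsnd Not) u) @ (a, \<not> e) # (a, \<not> \<not> e) # u)
          (rev (map (apsnd Not) u) @ u)"
    by (rule free_eq.cancel)
  with Cons.IH show ?case by (auto simp: p intro: free_eq.trans)
qed (simp add: free_eq.refl)

lemma group_free_group: "group free_group"
proof (rule groupI)
  fix x y z :: "'a free"
  show "x \<otimes>\<^bsub>free_group\<^esub> y \<otimes>\<^bsub>free_group\<^esub> z = x \<otimes>\<^bsub>free_group\<^esub> (y \<otimes>\<^bsub>free_group\<^esub> z)"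
    unfolding free_group_def by simp (transfer, simp add: free_eq.refl)
  show "\<one>\<^bsub>free_group\<^esub> \<otimes>\<^bsub>free_group\<^esub> x = x"
    unfolding free_group_def by simp (transfer, simp add: free_eq.refl)
  have "\<exists>y. free_mult y x = free_one"
    by transfer (blast intro: free_eq_inverse_left)
  then show "\<exists>y\<in>carrier free_group. y \<otimes>\<^bsub>free_group\<^esub> x = \<one>\<^bsub>free_group\<^esub>"
    by (simp add: free_group_def)
qed (simp_all add: free_group_def)

lemma (in group) normal_closure_normal:
  assumes "R \<subseteq> carrier G"
  shows "normal_closure G R \<lhd> G"
proof -
  have "carrier G \<lhd> G"
    by (simp add: normal_inv_iff subgroup_self)
  with assms have ne: "{N. N \<lhd> G \<and> R \<subseteq> N} \<noteq> {}"
    by blast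
  have "subgroup (normal_closure G R) G"
    unfolding normal_closure_def
    by (rule subgroups_Inter) (use ne in \<open>auto simp: normal_inv_iff\<close>)
  then show ?thesis
    by (auto simp: normal_inv_iff normal_closure_def)
qed

lemma group_presented_group: "group (presented_group rels)"
  unfolding presented_group_def
  by (intro normal.factorgroup_is_group group.normal_closure_normal group_free_group)
     (simp add: free_group_def)

lemma (in group) Inn_normal: "Inn G \<lhd> AutoGroup G"
proof -
  interpret A: group "AutoGroup G" by (rule AutoGroup)
  define c where "c g = (\<lambda>a\<in>carrier G. conj_by G a g)" for g
  have Inn_c: "Inn G = c ` carrier G"
    by (auto simp: Inn_def c_def)
  have carr: "carrier (AutoGroup G) = auto G"
    by (simp add: AutoGroup_def)
  have auto_Bij: "f \<in> Bij (carrier G)" if "f \<in> auto G" for f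
    using that by (simp add: auto_def)
  have mult: "f \<otimes>\<^bsub>AutoGroup G\<^esub> h = compose (carrier G) f h"
    if "f \<in> auto G" "h \<in> auto G" for f h
    using that by (simp add: AutoGroup_def BijGroup_def auto_Bij)
  have one: "\<one>\<^bsub>AutoGroup G\<^esub> = (\<lambda>a\<in>carrier G. a)"
    by (simp add: AutoGroup_def BijGroup_def)
  have cc: "compose (carrier G) (c g) (c h) = c (h \<otimes> g)"
    if "g \<in> carrier G" "h \<in> carrier G" for g h
    using that by (auto simp: c_def conj_by_def compose_def fun_eq_iff inv_mult_group m_assoc)
  have c1: "c \<one> = (\<lambda>a\<in>carrier G. a)"
    by (auto simp: c_def conj_by_def fun_eq_iff)
  have c_auto: "c g \<in> auto G" if g: "g \<in> carrier G" for g
  proof -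
    have "c g \<in> hom G G"
    proof (rule homI)
      fix a b assume "a \<in> carrier G" "b \<in> carrier G"
      with g show "c g (a \<otimes> b) = c g a \<otimes> c g b"
        by (simp add: c_def conj_by_def m_assoc inv_solve_left')
          (simp add: m_assoc[symmetric])
    qed (use g in \<open>simp add: c_def conj_by_def\<close>)
    moreover have "bij_betw (c g) (carrier G) (carrier G)"
    proof (rule bij_betw_byWitness[where f' = "c (inv g)"])
      show "\<forall>a\<in>carrier G. c (inv g) (c g a) = a" "\<forall>a\<in>carrier G. c g (c (inv g) a) = a"
        using g by (auto simp: c_def conj_by_def m_assoc inv_solve_left)
          (simp_all add: m_assoc[symmetric])
    qed (use g in \<open>auto simp: c_def conj_by_def\<close>)
    ultimately show ?thesis
      by (simp add: auto_def Bij_def c_def)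
  qed
  have "subgroup (Inn G) (AutoGroup G)"
  proof (rule A.subgroupI)
    fix f assume "f \<in> Inn G"
    then obtain g where g: "g \<in> carrier G" "f = c g" by (auto simp: Inn_c)
    have "c (inv g) \<otimes>\<^bsub>AutoGroup G\<^esub> c g = \<one>\<^bsub>AutoGroup G\<^esub>"
      using g by (simp add: mult c_auto cc one c1)
    with g have "inv\<^bsub>AutoGroup G\<^esub> f = c (inv g)"
      by (intro A.inv_equality) (auto simp: carr c_auto)
    then show "inv\<^bsub>AutoGroup G\<^esub> f \<in> Inn G" using g by (auto simp: Inn_c)
  qed (auto simp: Inn_c carr c_auto mult cc)
  moreover have "f \<otimes>\<^bsub>AutoGroup G\<^esub> h \<otimes>\<^bsub>AutoGroup G\<^esub> inv\<^bsub>AutoGroup G\<^esub> f \<in> Inn G"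
    if f: "f \<in> auto G" and "h \<in> Inn G" for f h
  proof -
    from that obtain g where g: "g \<in> carrier G" "h = c g" by (auto simp: Inn_c)
    have fh: "f \<in> hom G G" using f by (simp add: auto_def)
    have fg: "f g \<in> carrier G" using fh g(1) by (rule hom_in_carrier)
    interpret f: group_hom G G f
      using fh by unfold_locales
    have "compose (carrier G) f (c g) = compose (carrier G) (c (f g)) f"
      using g by (auto simp: compose_def c_def conj_by_def fun_eq_iff)
    then have "f \<otimes>\<^bsub>AutoGroup G\<^esub> h = c (f g) \<otimes>\<^bsub>AutoGroup G\<^esub> f"
      using f g fg by (simp add: mult c_auto)
    then have "f \<otimes>\<^bsub>AutoGroup G\<^esub> h \<otimes>\<^bsub>AutoGroup G\<^esub> inv\<^bsub>AutoGroup G\<^esub> f = c (f g)"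
      using f fg c_auto[OF fg] unfolding carr[symmetric] by (simp add: A.m_assoc)
    then show ?thesis using fg by (simp add: Inn_c)
  qed
  ultimately show ?thesis by (simp add: A.normal_inv_iff carr)
qed

lemma (in group) group_Out: "group (Out G)"
  unfolding Out_def by (intro normal.factorgroup_is_group Inn_normal)

lemma group_rat_group: "group rat_group"
proof (rule groupI)
  show "\<exists>y\<in>carrier rat_group. y \<otimes>\<^bsub>rat_group\<^esub> x = \<one>\<^bsub>rat_group\<^esub>" for x
    by (rule bexI[of _ "- x"]) (simp_all add: rat_group_def)
qed (simp_all add: rat_group_def)

end

theory Submission
  imports Defs
begin

text \<open>
  Let \<open>H = \<langle>x, y\<rangle>\<close>, the semidirect product of the dyadic rationals \<open>x\<^sup>a\<close> with the
  powers of \<open>y\<close>; the group \<open>G\<close> is the HNN extension of \<open>H\<close> with stable letter \<open>t\<close>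
  conjugating \<open>x\<close> to \<open>y\<close>, and acts on its Bass-Serre tree. For every dyadic \<open>q\<close> there is an
  automorphism fixing \<open>x\<close> and \<open>y\<close> and mapping \<open>t\<close> to \<open>x\<^sup>q t\<close>, because \<open>x\<^sup>q\<close> commutes
  with \<open>x\<close>. Conversely, let \<open>\<phi>\<close> be an automorphism. The relations force \<open>\<phi> x\<close> and
  \<open>\<phi> y\<close> to fix a common vertex, so after an inner automorphism both lie in \<open>H\<close>, and
  computing in \<open>H\<close> one can arrange \<open>\<phi> y = y\<close> and \<open>\<phi> x = x\<^sup>m\<close> with \<open>m\<close> odd. Then
  \<open>\<phi> t\<close> times the inverse of \<open>t\<close> conjugates \<open>x\<^sup>m\<close> to \<open>x\<close>, and the fixed-point sets of
  powers of \<open>x\<close> in the tree show that \<open>m = 1\<close> and that this element is some \<open>x\<^sup>q\<close>.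
\<close>

section \<open>Homomorphisms from presented groups\<close>

lemma (in group) inv_mult_cancel_left [simp]:
  assumes "a \<in> carrier G" "b \<in> carrier G"
  shows "inv a \<otimes> (a \<otimes> b) = b" "a \<otimes> (inv a \<otimes> b) = b"
  using assms by (simp_all flip: m_assoc)

primrec word_eval :: "('b, 'c) monoid_scheme \<Rightarrow> ('a \<Rightarrow> 'b) \<Rightarrow> 'a word \<Rightarrow> 'b" where
  "word_eval K f [] = \<one>\<^bsub>K\<^esub>"
| "word_eval K f (p # w) =
     (if snd p then f (fst p) else inv\<^bsub>K\<^esub> (f (fst p))) \<otimes>\<^bsub>K\<^esub> word_eval K f w"

text \<open>Any representative serves: \<open>word_eval_cong\<close> shows that freely equal words
  have the same value as soon as \<open>f\<close> maps into the group.\<close>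

definition free_eval :: "('b, 'c) monoid_scheme \<Rightarrow> ('a \<Rightarrow> 'b) \<Rightarrow> 'a free \<Rightarrow> 'b" where
  "free_eval K f z = word_eval K f (rep_free z)"

context group
begin

lemma word_eval_closed: "range f \<subseteq> carrier G \<Longrightarrow> word_eval G f w \<in> carrier G"
  by (induction w) auto

lemma word_eval_append:
  "range f \<subseteq> carrier G \<Longrightarrow> word_eval G f (u @ v) = word_eval G f u \<otimes> word_eval G f v"
proof (induction u)
  case (Cons p u)
  then have "f (fst p) \<in> carrier G" by auto
  with Cons show ?case by (auto simp: m_assoc word_eval_closed)
qed (simp add: word_eval_closed)

lemma word_eval_cong:
  assumes "free_eq u v" and f: "range f \<subseteq> carrier G"
  shows "word_eval G f u = word_eval G f v"
  using assms(1)
proof induction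
  case (cancel u a e v)
  have "f a \<in> carrier G" using f by auto
  then show ?case using f by (cases e) (simp_all add: word_eval_append word_eval_closed)
qed auto

lemma free_eval_abs:
  assumes f: "range f \<subseteq> carrier G"
  shows "free_eval G f (abs_free w) = word_eval G f w"
  unfolding free_eval_def
  by (rule word_eval_cong[OF _ f]) (meson Quotient_free Quotient_rep_abs free_eq.refl)

lemma free_eval_hom:
  assumes f: "range f \<subseteq> carrier G"
  shows "free_eval G f \<in> hom free_group G"
proof (rule homI)
  fix u v :: "'c free"
  show "free_eval G f u \<in> carrier G" using f by (simp add: free_eval_def word_eval_closed)
  obtain p q where "u = abs_free p" "v = abs_free q" by (metis Quotient_abs_rep Quotient_free)
  then show "free_eval G f (u \<otimes>\<^bsub>free_group\<^esub> v) = free_eval G f u \<otimes> free_eval G f v"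
    using f by (simp add: free_group_def free_mult.abs_eq free_eval_abs word_eval_append)
qed

lemma free_eval_gen:
  assumes f: "range f \<subseteq> carrier G"
  shows "free_eval G f (free_gen a) = f a"
proof -
  have "f a \<in> carrier G" using f by auto
  then show ?thesis unfolding free_gen.abs_eq free_eval_abs[OF f] by simp
qed

end

lemma free_group_carrier [simp]: "carrier free_group = UNIV"
  by (simp add: free_group_def)

lemma generate_free_group: "generate free_group (range free_gen) = UNIV"
proof -
  interpret F: group free_group by (rule group_free_group)
  have "abs_free w \<in> generate free_group (range free_gen)" for w
  proof (induction w)
    case Nil
    have "abs_free [] = \<one>\<^bsub>free_group\<^esub>" by (simp add: free_group_def free_one.abs_eq)
    then show ?case by (metis generate.one)
  next
    case (Cons p w)
    obtain a e where p: "p = (a, e)" by (cases p)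
    have pos: "free_gen a \<in> generate free_group (range free_gen)" for a
      by (simp add: generate.incl)
    have "abs_free [(a, False)] = inv\<^bsub>free_group\<^esub> (free_gen a)"
    proof (rule F.inv_equality[symmetric])
      have "free_eq ([] @ (a, False) # (a, \<not> False) # []) ([] @ [])" by (rule free_eq.cancel)
      then have "abs_free ([(a, False)] @ [(a, True)]) = abs_free []"
        by (simp add: free.abs_eq_iff)
      then show "abs_free [(a, False)] \<otimes>\<^bsub>free_group\<^esub> free_gen a = \<one>\<^bsub>free_group\<^esub>"
        by (simp add: free_group_def free_gen.abs_eq free_mult.abs_eq free_one.abs_eq)
    qed auto
    then have "abs_free [p] \<in> generate free_group (range free_gen)"
      using pos by (cases e) (auto simp: p free_gen.abs_eq[symmetric] intro: generate.inv)
    moreover have "abs_free (p # w) = abs_free [p] \<otimes>\<^bsub>free_group\<^esub> abs_free w"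
      by (simp add: free_group_def free_mult.abs_eq)
    ultimately show ?case using Cons by (simp add: generate.eng)
  qed
  then show ?thesis by (metis Quotient_abs_rep Quotient_free UNIV_eq_I)
qed

definition relators :: "('a free \<times> 'a free) set \<Rightarrow> 'a free set" where
  "relators rels = {u \<otimes>\<^bsub>free_group\<^esub> inv\<^bsub>free_group\<^esub> v | u v. (u, v) \<in> rels}"

definition quot_map :: "('a free \<times> 'a free) set \<Rightarrow> 'a free \<Rightarrow> 'a free set" where
  "quot_map rels z = normal_closure free_group (relators rels) #>\<^bsub>free_group\<^esub> z"

lemma relators_normal: "normal_closure free_group (relators rels) \<lhd> free_group"
  by (rule group.normal_closure_normal[OF group_free_group]) simp

lemma presented_group_alt:
  "presented_group rels = free_group Mod normal_closure free_group (relators rels)"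
  by (simp add: presented_group_def relators_def)

lemma quot_map_hom: "quot_map rels \<in> hom free_group (presented_group rels)"
  unfolding quot_map_def[abs_def] presented_group_alt
  by (rule normal.r_coset_hom_Mod[OF relators_normal])

lemma quot_map_surj: "quot_map rels ` UNIV = carrier (presented_group rels)"
  by (auto simp: quot_map_def presented_group_alt FactGroup_def RCOSETS_def)

lemma quot_map_rel:
  assumes "(u, v) \<in> rels"
  shows "quot_map rels u = quot_map rels v"
proof -
  interpret F: group free_group by (rule group_free_group)
  interpret P: group "presented_group rels" by (rule group_presented_group)
  interpret q: group_hom free_group "presented_group rels" "quot_map rels"
    by unfold_locales (rule quot_map_hom)
  interpret N: normal "normal_closure free_group (relators rels)" free_group
    by (rule relators_normal)
  have "u \<otimes>\<^bsub>free_group\<^esub> inv\<^bsub>free_group\<^esub> v \<in> normal_closure free_group (relators rels)"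
    using assms by (auto simp: normal_closure_def relators_def)
  then have "quot_map rels (u \<otimes>\<^bsub>free_group\<^esub> inv\<^bsub>free_group\<^esub> v) = \<one>\<^bsub>presented_group rels\<^esub>"
    by (simp add: quot_map_def presented_group_alt FactGroup_def F.coset_join2 N.subgroup_axioms)
  then have "quot_map rels u \<otimes>\<^bsub>presented_group rels\<^esub> inv\<^bsub>presented_group rels\<^esub> quot_map rels v
      = \<one>\<^bsub>presented_group rels\<^esub>" by simp
  then show ?thesis using q.hom_closed by (metis P.inv_equality P.inv_inv P.inv_closed free_group_carrier UNIV_I)
qed

lemma presented_group_generate:
  "generate (presented_group rels) (range (\<lambda>a. quot_map rels (free_gen a))) = carrier (presented_group rels)"
proof -
  interpret q: group_hom free_group "presented_group rels" "quot_map rels"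
    using quot_map_hom by (simp add: group_hom_def group_hom_axioms_def group_free_group group_presented_group)
  have "generate (presented_group rels) (quot_map rels ` range free_gen) = quot_map rels ` UNIV"
    using q.generate_img[of "range free_gen"] by (simp add: generate_free_group)
  then show ?thesis by (simp add: quot_map_surj image_image)
qed

text \<open>Von Dyck's theorem. The kernel of the evaluation is a normal subgroup containing the
  relators, hence contains their normal closure, and the evaluation factors through the
  quotient.\<close>

lemma presented_group_universal:
  assumes K: "group K" and f: "range f \<subseteq> carrier K"
    and rels: "\<And>u v. (u, v) \<in> rels \<Longrightarrow> free_eval K f u = free_eval K f v"
  obtains \<phi> where "\<phi> \<in> hom (presented_group rels) K"
    "\<And>a. \<phi> (quot_map rels (free_gen a)) = f a"
proof -
  interpret K: group K by (rule K)
  interpret F: group free_group by (rule group_free_group)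
  interpret e: group_hom free_group K "free_eval K f"
    by unfold_locales (rule K.free_eval_hom[OF f])
  let ?N = "normal_closure free_group (relators rels)"
  have "relators rels \<subseteq> kernel free_group K (free_eval K f)"
    using rels e.hom_closed by (auto simp: relators_def kernel_def)
  then have "?N \<subseteq> kernel free_group K (free_eval K f)"
    unfolding normal_closure_def using e.normal_kernel by auto
  then obtain g where "g \<in> hom (free_group Mod ?N) K"
    "\<And>z. z \<in> carrier free_group \<Longrightarrow> g (?N #>\<^bsub>free_group\<^esub> z) = free_eval K f z"
    using e.FactGroup_universal_kernel[OF relators_normal] by blast
  then show thesis
    using that[of g] K.free_eval_gen[OF f] by (simp add: presented_group_alt quot_map_def)
qed

section \<open>Groups acting on trees of words\<close>

fun lcp :: "'a list \<Rightarrow> 'a list \<Rightarrow> nat" where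
  "lcp (a # u) (b # v) = (if a = b then Suc (lcp u v) else 0)"
| "lcp _ _ = 0"

lemma lcp_Nil [simp]: "lcp u [] = 0" "lcp [] u = 0"
  by (cases u; simp)+

lemma lcp_self [simp]: "lcp u u = length u"
  by (induction u) auto

lemma lcp_commute: "lcp u v = lcp v u"
  by (induction u v rule: lcp.induct) auto

lemma lcp_le: "lcp u v \<le> length u"
  by (induction u v rule: lcp.induct) auto

lemma lcp_eq_length: "lcp u v = length u \<Longrightarrow> lcp u v = length v \<Longrightarrow> u = v"
  by (induction u v rule: lcp.induct) (auto split: if_splits)

lemma lcp_ultrametric: "min (lcp u v) (lcp v w) \<le> lcp u w"
proof (induction u v arbitrary: w rule: lcp.induct)
  case (1 a u b v)
  show ?case
  proof (cases w)
    case (Cons c w')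
    then show ?thesis using 1[of w'] by (auto simp: min_def split: if_splits)
  qed auto
qed auto

lemma lcp_take: "lcp (take n u) u = min n (length u)"
proof (induction u arbitrary: n)
  case (Cons a u)
  then show ?case by (cases n) auto
qed auto

text \<open>Words are the vertices of a rooted tree in which a word is joined to its extensions by
  one letter; the geodesic from \<open>u\<close> to \<open>v\<close> runs through their longest
  common prefix.\<close>

definition tdist :: "'a list \<Rightarrow> 'a list \<Rightarrow> int" where
  "tdist u v = int (length u) + int (length v) - 2 * int (lcp u v)"

lemma tdist_self [simp]: "tdist u u = 0"
  by (simp add: tdist_def)

lemma tdist_Nil [simp]: "tdist u [] = int (length u)" "tdist [] u = int (length u)"
  by (simp_all add: tdist_def)

lemma tdist_commute: "tdist u v = tdist v u"
  by (simp add: tdist_def lcp_commute)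

lemma tdist_le_0: "tdist u v \<le> 0 \<Longrightarrow> u = v"
  using lcp_le[of u v] lcp_le[of v u] lcp_eq_length[of u v] by (simp add: tdist_def lcp_commute)

text \<open>Gromov's four-point condition for trees; it comes from the ultrametric inequality for
  common prefixes.\<close>

lemma tdist_four_point:
  "tdist u v + tdist w z \<le> max (tdist u w + tdist v z) (tdist u z + tdist v w)"
  using lcp_ultrametric[of u w v] lcp_ultrametric[of u z v]
    lcp_ultrametric[of w u z] lcp_ultrametric[of w v z]
    lcp_commute[of u w] lcp_commute[of u z] lcp_commute[of v w] lcp_commute[of v z]
    lcp_commute[of u v] lcp_commute[of w z]
  unfolding tdist_def min_def max_def by (simp split: if_splits)

lemma tdist_triangle: "tdist u w \<le> tdist u v + tdist v w"
  using tdist_four_point[of u w v v] by (simp add: tdist_commute)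

lemma tdist_take: "n \<le> length u \<Longrightarrow> tdist (take n u) u = int (length u) - int n"
  by (simp add: tdist_def lcp_take)

text \<open>In the four-point condition for \<open>m\<close>, \<open>m'\<close>, \<open>a\<close>,
  \<open>b\<close> both sums on the right equal \<open>r + s\<close>, which is also
  \<open>tdist a b\<close>; this leaves \<open>tdist m m' \<le> 0\<close>.\<close>

lemma tdist_geodesic_unique:
  assumes "tdist a m = r" "tdist a m' = r" "tdist b m = s" "tdist b m' = s" "tdist a b = r + s"
  shows "m = m'"
  using tdist_four_point[of m m' a b] assms
  by (intro tdist_le_0) (simp add: tdist_commute)

lemma lcp_pos_take: "lcp u v > 0 \<Longrightarrow> take (Suc 0) u = take (Suc 0) v"
  by (cases "(u, v)" rule: lcp.cases) (auto split: if_splits)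

section \<open>Isometric actions on a rooted tree\<close>

locale rooted_tree_action = group G for G (structure) +
  fixes V :: "'v list set" and act :: "'a \<Rightarrow> 'v list \<Rightarrow> 'v list"
  assumes act_closed: "g \<in> carrier G \<Longrightarrow> v \<in> V \<Longrightarrow> act g v \<in> V"
    and act_one: "v \<in> V \<Longrightarrow> act \<one> v = v"
    and act_mult: "g \<in> carrier G \<Longrightarrow> h \<in> carrier G \<Longrightarrow> v \<in> V \<Longrightarrow> act (g \<otimes> h) v = act g (act h v)"
    and act_dist: "g \<in> carrier G \<Longrightarrow> u \<in> V \<Longrightarrow> v \<in> V \<Longrightarrow> tdist (act g u) (act g v) = tdist u v"
    and Nil_V: "[] \<in> V"
    and take_V: "v \<in> V \<Longrightarrow> take n v \<in> V"
    and act_transitive: "v \<in> V \<Longrightarrow> \<exists>g\<in>carrier G. act g [] = v"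
begin

text \<open>Since the action is transitive, \<open>len (inv k \<otimes> g \<otimes> k)\<close> runs
  over all distances by which \<open>g\<close> moves a vertex: conjugation replaces a change of base
  vertex.\<close>

abbreviation len :: "'a \<Rightarrow> nat" where "len g \<equiv> length (act g [])"

lemma act_inv_cancel:
  assumes "g \<in> carrier G" "v \<in> V"
  shows "act (inv g) (act g v) = v" "act g (act (inv g) v) = v"
  using assms act_mult[of "inv g" g v] act_mult[of g "inv g" v] by (simp_all add: act_one)

lemma act_V [simp]: "g \<in> carrier G \<Longrightarrow> act g [] \<in> V"
  by (simp add: act_closed Nil_V)

lemma tdist_act_Nil:
  assumes "g \<in> carrier G" "h \<in> carrier G"
  shows "tdist (act g []) (act h []) = int (len (inv g \<otimes> h))"
  using assms act_dist[of "inv g" "act g []" "act h []"]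
  by (simp add: act_inv_cancel Nil_V act_mult)

lemma len_inv: "g \<in> carrier G \<Longrightarrow> len (inv g) = len g"
  using tdist_act_Nil[of g \<one>] by (simp add: act_one Nil_V)

lemma len_mult_le:
  assumes "g \<in> carrier G" "h \<in> carrier G"
  shows "len (g \<otimes> h) \<le> len g + len h"
proof -
  have "tdist (act (inv g) []) (act h []) \<le> tdist (act (inv g) []) [] + tdist [] (act h [])"
    by (rule tdist_triangle)
  then show ?thesis using assms by (simp add: tdist_act_Nil len_inv)
qed

text \<open>The tree is bipartite, which excludes inversions of edges below.\<close>

lemma even_len_mult:
  assumes "g \<in> carrier G" "h \<in> carrier G"
  shows "even (len (g \<otimes> h)) \<longleftrightarrow> (even (len g) \<longleftrightarrow> even (len h))"
proof -
  have "int (len (g \<otimes> h)) = tdist (act (inv g) []) (act h [])"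
    using assms by (simp add: tdist_act_Nil)
  then have "even (int (len (g \<otimes> h))) \<longleftrightarrow> (even (int (len g)) \<longleftrightarrow> even (int (len h)))"
    using assms by (simp add: tdist_def len_inv)
  then show ?thesis by simp
qed

text \<open>If the paths from the root to \<open>act g []\<close> and to
  \<open>act (inv g) []\<close> shared their first edge, the other end of that edge would be moved
  less than the root. So the root lies on the axis of \<open>g\<close>, along which the powers
  translate. Parity rules out \<open>len g = 1\<close>, where \<open>g\<close> could invert an
  edge.\<close>

lemma len_power_of_minimal:
  assumes g: "g \<in> carrier G" and even: "even (len g)" and pos: "len g > 0"
    and min: "\<And>k. k \<in> carrier G \<Longrightarrow> len g \<le> len (inv k \<otimes> g \<otimes> k)"
  shows "len (g [^] n) = n * len g"
proof -
  let ?L = "len g"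
  have L2: "?L \<ge> 2" using even pos by presburger
  let ?w = "act g []" and ?w' = "act (inv g) []"
  have lcp0: "lcp ?w ?w' = 0"
  proof (rule ccontr)
    assume "lcp ?w ?w' \<noteq> 0"
    then have eq: "take (Suc 0) ?w = take (Suc 0) ?w'" by (simp add: lcp_pos_take)
    define v where "v = take (Suc 0) ?w"
    have vV: "v \<in> V" unfolding v_def using g by (simp add: take_V)
    obtain k where k: "k \<in> carrier G" "act k [] = v" using act_transitive[OF vV] by blast
    have "tdist [] v = 1" using L2 by (simp add: v_def)
    then have d1: "tdist ?w (act g v) = 1" using act_dist[OF g Nil_V vV] by simp
    have "tdist v ?w' = int ?L - 1"
      using tdist_take[of "Suc 0" ?w'] g L2 by (simp add: v_def eq len_inv)
    then have d2: "tdist [] (act g v) = int ?L - 1"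
      using act_dist[OF g vV, of ?w'] g
      by (simp add: act_inv_cancel Nil_V tdist_commute)
    \<comment> \<open>Both are the last vertex before \<open>?w\<close> on the path from the root:
      at distance 1 from \<open>?w\<close> and \<open>?L - 1\<close> from the root.\<close>
    have "take (?L - 1) ?w = act g v"
    proof (rule tdist_geodesic_unique[of "[]" _ "int ?L - 1" _ ?w 1])
      show "tdist ?w (take (?L - 1) ?w) = 1"
        using tdist_take[of "?L - 1" ?w] L2 by (simp add: tdist_commute)
    qed (use d1 d2 L2 in auto)
    moreover have "v = take (Suc 0) (take (?L - 1) ?w)" using L2 by (simp add: v_def)
    then have "tdist v (take (?L - 1) ?w) = int ?L - 2"
      using tdist_take[of "Suc 0" "take (?L - 1) ?w"] L2 by simp
    ultimately have "tdist v (act g v) = int ?L - 2" by simp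
    moreover have "tdist v (act g v) = int (len (inv k \<otimes> g \<otimes> k))"
      using k g tdist_act_Nil[of k "g \<otimes> k"] act_mult[OF g k(1) Nil_V] by (simp add: m_assoc)
    ultimately show False using min[OF k(1)] L2 by linarith
  qed
  have lcp_iff: "lcp ?w' (act (g [^] m) []) = 0 \<longleftrightarrow> len (g [^] Suc m) = ?L + len (g [^] m)" for m
  proof -
    have "int (len (g [^] Suc m)) = tdist ?w' (act (g [^] m) [])"
      unfolding nat_pow_Suc2[OF g] using tdist_act_Nil[of "inv g" "g [^] m"] g by simp
    then show ?thesis using g by (auto simp: tdist_def len_inv simp del: nat_pow_Suc)
  qed
  \<comment> \<open>The word \<open>act (g [^] Suc m) []\<close> begins with all of
    \<open>?w\<close>, and \<open>?w\<close> and \<open>?w'\<close> already differ in the first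
    letter.\<close>
  have step: "lcp ?w' (act (g [^] Suc m) []) = 0" if "lcp ?w' (act (g [^] m) []) = 0" for m
  proof -
    have "len (g [^] Suc m) = ?L + len (g [^] m)" using that lcp_iff by blast
    moreover have "int (len (g [^] m)) = tdist ?w (act (g [^] Suc m) [])"
      unfolding nat_pow_Suc2[OF g] using tdist_act_Nil[of g "g \<otimes> g [^] m"] g by simp
    ultimately have "lcp ?w (act (g [^] Suc m) []) = ?L" by (simp add: tdist_def)
    then show ?thesis using lcp0 pos
      lcp_ultrametric[of ?w "act (g [^] Suc m) []" ?w'] by (simp add: lcp_commute min_def split: if_splits)
  qed
  have "lcp ?w' (act (g [^] m) []) = 0" for m :: nat
    by (induction m) (use step in \<open>auto simp: act_one Nil_V simp del: nat_pow_Suc\<close>)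
  then have rec: "len (g [^] Suc m) = ?L + len (g [^] m)" for m :: nat using lcp_iff by blast
  show ?thesis by (induction n) (use rec in \<open>auto simp: act_one Nil_V simp del: nat_pow_Suc\<close>)
qed

text \<open>A hyperbolic \<open>x\<close> would make the length of \<open>x ^ (2 ^ n)\<close> grow exponentially, whereas
  \<open>y\<^sup>-\<^sup>n x y\<^sup>n\<close> grows only linearly.\<close>

lemma square_conj_elliptic:
  assumes x: "x \<in> carrier G" and y: "y \<in> carrier G"
    and rel: "inv y \<otimes> x \<otimes> y = x \<otimes> x"
  shows "\<exists>u\<in>carrier G. act (inv u \<otimes> x \<otimes> u) [] = []"
proof -
  define P where "P u = len (inv u \<otimes> x \<otimes> u)" for u
  \<comment> \<open>A conjugate of minimal displacement, so that \<open>len_power_of_minimal\<close>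
    applies.\<close>
  obtain u where u: "u \<in> carrier G" and umin: "\<And>k. k \<in> carrier G \<Longrightarrow> P u \<le> P k"
    using arg_min_nat_lemma[of "\<lambda>u. u \<in> carrier G" \<one> P] by auto
  define g h where "g = inv u \<otimes> x \<otimes> u" and "h = inv u \<otimes> y \<otimes> u"
  have cl: "g \<in> carrier G" "h \<in> carrier G" using x y u by (auto simp: g_def h_def)
  have rel': "inv h \<otimes> g \<otimes> h = g \<otimes> g"
  proof -
    have "inv h \<otimes> g \<otimes> h = inv u \<otimes> (inv y \<otimes> x \<otimes> y) \<otimes> u"
      using x y u by (simp add: g_def h_def inv_mult_group m_assoc)
    also have "\<dots> = g \<otimes> g"
      unfolding rel using x y u by (simp add: g_def m_assoc)
    finally show ?thesis .
  qed
  have "len g = 0"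
  proof (rule ccontr)
    assume "len g \<noteq> 0"
    \<comment> \<open>Conjugation preserves the parity of \<open>len\<close>, and squares have even
      \<open>len\<close>.\<close>
    moreover have "even (len g)"
    proof -
      have "even (len (inv h \<otimes> g \<otimes> h)) \<longleftrightarrow> even (len g)"
        using cl by (auto simp: even_len_mult len_inv)
      then show ?thesis unfolding rel' using cl by (auto simp: even_len_mult)
    qed
    moreover have "len g \<le> len (inv k \<otimes> g \<otimes> k)" if "k \<in> carrier G" for k
      using umin[of "u \<otimes> k"] that u x by (simp add: P_def g_def inv_mult_group m_assoc)
    ultimately have pow: "len (g [^] n) = n * len g" for n
      using len_power_of_minimal[OF cl(1)] by blast
    have conj: "inv (h [^] n) \<otimes> g \<otimes> h [^] n = g [^] (2 ^ n :: nat)" for n :: nat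
    proof (induction n)
      case (Suc n)
      have hc: "inv h \<otimes> (g [^] m) \<otimes> h = (g \<otimes> g) [^] m" for m :: nat
      proof (induction m)
        case (Suc m)
        have "inv h \<otimes> (g [^] Suc m) \<otimes> h = (inv h \<otimes> (g [^] m) \<otimes> h) \<otimes> (inv h \<otimes> g \<otimes> h)"
          using cl by (simp add: m_assoc)
        then show ?case using Suc rel' by simp
      qed (use cl in simp)
      have "inv (h [^] Suc n) \<otimes> g \<otimes> h [^] Suc n = inv h \<otimes> (inv (h [^] n) \<otimes> g \<otimes> h [^] n) \<otimes> h"
        using cl by (simp add: inv_mult_group m_assoc)
      also have "\<dots> = (g \<otimes> g) [^] (2 ^ n :: nat)" using Suc hc by simp
      also have "\<dots> = g [^] (2 ^ Suc n :: nat)"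
        using cl nat_pow_pow[of g 2 "2 ^ n"] by (simp add: numeral_2_eq_2)
      finally show ?case .
    qed (use cl in simp)
    have lin: "len (h [^] n) \<le> n * len h" for n :: nat
    proof (induction n)
      case (Suc n)
      then show ?case using len_mult_le[of "h [^] n" h] cl by simp
    qed (simp add: act_one Nil_V)
    have bound: "2 ^ n * len g \<le> 2 * n * len h + len g" for n :: nat
    proof -
      have "len (inv (h [^] n) \<otimes> g \<otimes> h [^] n) \<le> len (inv (h [^] n) \<otimes> g) + len (h [^] n)"
        using cl by (intro len_mult_le) auto
      also have "\<dots> \<le> len (inv (h [^] n)) + len g + len (h [^] n)"
        using cl by (intro add_mono len_mult_le) auto
      also have "\<dots> \<le> 2 * n * len h + len g" using lin[of n] cl by (simp add: len_inv)
      finally show ?thesis by (simp add: conj pow)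
    qed
    have sq: "n * n \<le> 2 ^ (n + 1)" for n :: nat
    proof (induction n)
      case (Suc n)
      then show ?case
      proof (cases "n \<le> 2")
        case False
        then have "2 * n + 1 \<le> n * n" using mult_le_mono1[of 3 n n] by linarith
        then show ?thesis using Suc by simp
      qed (auto simp: numeral_2_eq_2 le_Suc_eq)
    qed simp
    \<comment> \<open>This choice makes \<open>n * n\<close> exceed
      \<open>4 * n * len h + 2\<close>, while \<open>sq\<close> and \<open>bound\<close> together
      force the opposite.\<close>
    define n where "n = 4 * len h + 3"
    have "n * n * len g \<le> 2 * (2 ^ n * len g)" using sq[of n] by simp
    also have "\<dots> \<le> 4 * n * len h + 2 * len g" using bound[of n] by linarith
    also have "\<dots> \<le> (4 * n * len h + 2) * len g" using \<open>len g \<noteq> 0\<close> by (auto simp: add_mult_distrib Suc_le_eq)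
    finally have "n * n \<le> 4 * n * len h + 2"
      using \<open>len g \<noteq> 0\<close> by (metis mult_le_cancel2 neq0_conv)
    moreover have "n * n = 4 * n * len h + 3 * n" by (simp add: n_def algebra_simps)
    ultimately have "3 * n \<le> 2" by linarith
    then show False by (simp add: n_def)
  qed
  then show ?thesis using u unfolding g_def by auto
qed

lemma fixes_root_conj:
  assumes "u \<in> carrier G" "g \<in> carrier G"
  shows "act (inv u \<otimes> g \<otimes> u) [] = [] \<longleftrightarrow> act g (act u []) = act u []"
  using assms by (metis act_V act_inv_cancel act_mult inv_closed m_closed Nil_V)

text \<open>Since \<open>y\<close> preserves the fixed-point set of \<open>x\<close>, a shortest path from a fixed point
  of \<open>x\<close> to one of \<open>y\<close> has length 0.\<close>

theorem square_conj_common_fixed_point: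
  assumes x: "x \<in> carrier G" and y: "y \<in> carrier G" and t: "t \<in> carrier G"
    and rel: "inv y \<otimes> x \<otimes> y = x \<otimes> x" and yt: "y = inv t \<otimes> x \<otimes> t"
  obtains u where "u \<in> carrier G" "act (inv u \<otimes> x \<otimes> u) [] = []" "act (inv u \<otimes> y \<otimes> u) [] = []"
proof -
  obtain p0 where p0: "p0 \<in> carrier G" "act (inv p0 \<otimes> x \<otimes> p0) [] = []"
    using square_conj_elliptic[OF x y rel] by blast
  \<comment> \<open>As \<open>y\<close> is the conjugate of \<open>x\<close> by \<open>t\<close>,
    the inverse of \<open>t\<close> carries vertices fixed by \<open>x\<close> to vertices fixed by
    \<open>y\<close>.\<close>
  define q0 where "q0 = inv t \<otimes> p0"
  have q0: "q0 \<in> carrier G" "act (inv q0 \<otimes> y \<otimes> q0) [] = []"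
  proof -
    have "inv q0 \<otimes> y \<otimes> q0 = inv p0 \<otimes> x \<otimes> p0"
      using x t p0 by (simp add: q0_def yt inv_mult_group m_assoc)
    then show "act (inv q0 \<otimes> y \<otimes> q0) [] = []" using p0 x t by simp
  qed (use t p0 in \<open>simp add: q0_def\<close>)
  \<comment> \<open>Vertices are represented by group elements that move the root there.
    \<open>F\<close> collects the pairs of a vertex fixed by \<open>x\<close> and a vertex fixed by
    \<open>y\<close>, and \<open>D\<close> is the distance between the two.\<close>
  define F where "F r \<longleftrightarrow> fst r \<in> carrier G \<and> snd r \<in> carrier G
    \<and> act x (act (fst r) []) = act (fst r) [] \<and> act y (act (snd r) []) = act (snd r) []" for r
  define D where "D r = len (inv (snd r) \<otimes> fst r)" for r
  have "F (p0, q0)"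
    using p0 q0 x y by (simp add: F_def fixes_root_conj)
  then obtain r where r: "F r" and rmin: "\<And>s. F s \<Longrightarrow> D r \<le> D s"
    using arg_min_nat_lemma[of F "(p0, q0)" D] by blast
  obtain p q where pq: "r = (p, q)" by (cases r)
  have cl: "p \<in> carrier G" "q \<in> carrier G" using r by (auto simp: F_def pq)
  have fp: "act x (act p []) = act p []" and fq: "act y (act q []) = act q []"
    using r by (auto simp: F_def pq)
  \<comment> \<open>After translation by \<open>inv q\<close> the fixed vertex of \<open>y\<close>
    is the root, \<open>y'\<close> plays the part of \<open>y\<close>, and \<open>w\<close> below is
    the fixed vertex of \<open>x\<close>.\<close>
  define y' where "y' = inv q \<otimes> y \<otimes> q"
  have y': "y' \<in> carrier G" "act y' [] = []" using y cl fq by (auto simp: y'_def fixes_root_conj)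
  define w where "w = act (inv q \<otimes> p) []"
  have wV: "w \<in> V" using cl by (simp add: w_def)
  have qw: "act q w = act p []"
    using cl by (simp add: w_def act_mult[symmetric] Nil_V)
  have "w = []"
  proof (rule ccontr)
    assume wne: "w \<noteq> []"
    have lw: "length (act y' w) = length w"
      using act_dist[of y' "[]" w] y' wV Nil_V by simp
    show False
    proof (cases "lcp w (act y' w) = 0")
      \<comment> \<open>\<open>y'\<close> fixes the root, and the paths to \<open>w\<close> and
        \<open>act y' w\<close> share their first edge, so \<open>y'\<close> fixes the end
        \<open>v\<close> of that edge, which is closer to \<open>w\<close>.\<close>
      case False
      define v where "v = take (Suc 0) w"
      have vV: "v \<in> V" by (simp add: v_def take_V wV)
      have dv: "tdist [] v = 1" "tdist w v = int (length w) - 1"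
        using wne tdist_take[of "Suc 0" w] by (cases w; simp add: v_def tdist_commute)+
      have vt: "v = take (Suc 0) (act y' w)" using False by (simp add: v_def lcp_pos_take)
      have "act y' v = v"
      proof (rule tdist_geodesic_unique[of "[]" _ 1 _ "act y' w" "int (length w) - 1"])
        show "tdist [] (act y' v) = 1" using act_dist[of y' "[]" v] y' vV Nil_V dv by simp
        show "tdist (act y' w) (act y' v) = int (length w) - 1"
          using act_dist[of y' w v] y' vV wV dv by simp
        show "tdist (act y' w) v = int (length w) - 1"
          using tdist_take[of "Suc 0" "act y' w"] wne lw
          by (simp add: vt tdist_commute Suc_le_eq)
      qed (use dv lw in auto)
      moreover obtain k where k: "k \<in> carrier G" "act k [] = v"
        using act_transitive[OF vV] by blast
      moreover have "q \<otimes> y' = y \<otimes> q" using cl y by (simp add: y'_def m_assoc)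
      ultimately have "act y (act (q \<otimes> k) []) = act (q \<otimes> k) []"
        using y cl y' vV by (metis act_mult Nil_V)
      then have "F (p, q \<otimes> k)" using cl k fp by (simp add: F_def)
      from rmin[OF this] have "len (inv q \<otimes> p) \<le> len (inv k \<otimes> (inv q \<otimes> p))"
        using cl k by (simp add: D_def pq inv_mult_group m_assoc)
      then have "int (length w) \<le> tdist v w"
        using tdist_act_Nil[of k "inv q \<otimes> p"] cl k by (simp add: w_def)
      then show False using dv by (simp add: tdist_commute)
    next
      \<comment> \<open>Now the root is the midpoint between \<open>w\<close> and
        \<open>act y' w\<close>. By \<open>x y = y x^2\<close> the vertex \<open>yp\<close> is fixed
        by \<open>x\<close> as well, and with both ends \<open>x\<close> fixes the midpoint
        \<open>act q []\<close>.\<close>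
      case True
      then have far: "tdist w (act y' w) = int (length w) + int (length w)"
        using lw by (simp add: tdist_def)
      define yp where "yp = act y (act p [])"
      have ypV: "yp \<in> V" using y cl by (simp add: yp_def act_closed)
      have "x \<otimes> y = y \<otimes> (x \<otimes> x)" unfolding rel[symmetric] using x y by (simp flip: m_assoc)
      then have xyp: "act x yp = yp"
        using x y cl fp by (metis act_mult act_V m_closed yp_def)
      have "q \<otimes> y' = y \<otimes> q" using cl y by (simp add: y'_def m_assoc)
      then have qyw: "act q (act y' w) = yp"
        using y cl y' wV qw by (metis act_mult yp_def)
      have xq: "act x (act q []) = act q []"
      proof (rule tdist_geodesic_unique[of "act p []" _ "int (length w)" _ yp "int (length w)"])
        show d1: "tdist (act p []) (act q []) = int (length w)"
          using act_dist[of q w "[]"] cl wV Nil_V qw by simp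
        show d2: "tdist yp (act q []) = int (length w)"
          using act_dist[of q "act y' w" "[]"] cl wV Nil_V qyw lw y' act_closed by simp
        show "tdist (act p []) (act x (act q [])) = int (length w)"
          using act_dist[of x "act p []" "act q []"] x cl fp d1 by simp
        show "tdist yp (act x (act q [])) = int (length w)"
          using act_dist[of x yp "act q []"] x cl xyp d2 ypV by simp
        show "tdist (act p []) yp = int (length w) + int (length w)"
          using act_dist[of q w "act y' w"] cl wV qyw qw y' act_closed far by simp
      qed
      then have "F (q, q)" using cl fq by (simp add: F_def)
      from rmin[OF this] have "length w = 0"
        using cl by (simp add: D_def pq w_def act_one Nil_V)
      then show False using wne by simp
    qed
  qed
  then have "act p [] = act q []" using qw by simp
  then show thesis using that[of q] x y cl fp fq by (simp add: fixes_root_conj)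
qed

end

section \<open>The Bass-Serre tree of the Baumslag-Gersten group\<close>

definition dyadic :: "rat set" where
  "dyadic = {of_int m / 2 ^ i | m i. True}"

lemma dyadicI: "q = of_int m / 2 ^ i \<Longrightarrow> q \<in> dyadic"
  by (auto simp: dyadic_def)

lemma dyadicE:
  assumes "q \<in> dyadic"
  obtains m i where "q = of_int m / 2 ^ i"
  using assms by (auto simp: dyadic_def)

lemma dyadic_add: "a \<in> dyadic \<Longrightarrow> b \<in> dyadic \<Longrightarrow> a + b \<in> dyadic"
proof (elim dyadicE)
  fix m n :: int and i j assume "a = of_int m / 2 ^ i" "b = of_int n / 2 ^ j"
  then show "a + b \<in> dyadic"
    by (intro dyadicI[of _ "m * 2 ^ j + n * 2 ^ i" "i + j"]) (simp add: add_divide_distrib power_add)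
qed

lemma dyadic_minus: "a \<in> dyadic \<Longrightarrow> - a \<in> dyadic"
  by (elim dyadicE) (auto intro: dyadicI[of _ "- m" i for m i])

lemma dyadic_diff: "a \<in> dyadic \<Longrightarrow> b \<in> dyadic \<Longrightarrow> a - b \<in> dyadic"
  using dyadic_add[of a "- b"] dyadic_minus[of b] by simp

lemma dyadic_of_int [simp]: "of_int m \<in> dyadic"
  by (rule dyadicI[of _ m 0]) simp

lemma dyadic_0 [simp]: "0 \<in> dyadic" and dyadic_1 [simp]: "1 \<in> dyadic"
  and dyadic_numeral [simp]: "numeral n \<in> dyadic"
  using dyadic_of_int[of 0] dyadic_of_int[of 1] dyadic_of_int[of "numeral n"] by simp_all

lemma dyadic_mult_powi: "a \<in> dyadic \<Longrightarrow> a * 2 powi k \<in> dyadic"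
proof (elim dyadicE)
  fix m :: int and i assume a: "a = of_int m / 2 ^ i"
  show "a * 2 powi k \<in> dyadic"
  proof (cases "k \<ge> 0")
    case True
    then show ?thesis by (intro dyadicI[of _ "m * 2 ^ nat k" i]) (simp add: a power_int_def)
  next
    case False
    then show ?thesis
      by (intro dyadicI[of _ m "i + nat (- k)"]) (simp add: a power_int_def power_add field_simps)
  qed
qed

lemma dyadic_divide_powi: "a \<in> dyadic \<Longrightarrow> a / 2 powi k \<in> dyadic"
  using dyadic_mult_powi[of a "- k"] by (simp add: power_int_minus divide_inverse)

text \<open>The pair \<open>(b, l)\<close> stands for the element \<open>x\<^sup>b y\<^sup>l\<close> of the vertex group
  \<open>H = \<langle>x, y\<rangle>\<close>, which is the semidirect product of the dyadic rationals with the integers. The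
  letters are coset representatives of the edge groups in \<open>H\<close>: \<open>Pos a k\<close> is the coset of
  \<open>x\<^sup>a y\<^sup>k\<close> modulo \<open>x\<close> followed by \<open>t\<close>, and \<open>Neg a\<close> is the coset of
  \<open>x\<^sup>a\<close> modulo \<open>y\<close> followed by the inverse of \<open>t\<close>. Reduced words are the vertices of
  the Bass-Serre tree.\<close>

datatype letter = Pos rat int | Neg rat

text \<open>Left multiplication by \<open>x^b y^l\<close>, based on
  \<open>y^l x^a = x^(a / 2^l) y^l\<close>. For \<open>Pos\<close> the integer power split off by
  the floor passes the stable letter as \<open>x^n t = t y^n\<close>; for \<open>Neg\<close> the
  power of \<open>y\<close> passes as \<open>y^l t^-1 = t^-1 x^l\<close>.\<close>

fun hact :: "rat \<Rightarrow> int \<Rightarrow> letter list \<Rightarrow> letter list" where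
  "hact b l [] = []"
| "hact b l (Pos a k # w) =
     (let c = b + a / 2 powi l; n = \<lfloor>c * 2 powi (l + k)\<rfloor>
      in Pos (c - of_int n / 2 powi (l + k)) (l + k) # hact 0 n w)"
| "hact b l (Neg a # w) = Neg (b + a / 2 powi l) # hact (of_int l) 0 w"

text \<open>Right multiplication of \<open>x^a y^k\<close> by \<open>x\<close> adds
  \<open>2^-k\<close> to \<open>a\<close>, so the half-open interval contains exactly one
  representative of each coset.\<close>

fun valid_letter :: "letter \<Rightarrow> bool" where
  "valid_letter (Pos a k) \<longleftrightarrow> a \<in> dyadic \<and> 0 \<le> a \<and> a * 2 powi k < 1"
| "valid_letter (Neg a) \<longleftrightarrow> a \<in> dyadic"

text \<open>These are the pairs in which \<open>t\<close> and its inverse meet with the trivial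
  coset in between.\<close>

fun cancels :: "letter \<Rightarrow> letter list \<Rightarrow> bool" where
  "cancels (Pos a k) (Neg b # w) \<longleftrightarrow> b = 0"
| "cancels (Neg a) (Pos b k # w) \<longleftrightarrow> b = 0 \<and> k = 0"
| "cancels _ _ \<longleftrightarrow> False"

fun reduced :: "letter list \<Rightarrow> bool" where
  "reduced [] \<longleftrightarrow> True"
| "reduced (p # w) \<longleftrightarrow> valid_letter p \<and> reduced w \<and> \<not> cancels p w"

text \<open>Left multiplication by \<open>t\<close>, where the letter \<open>Pos 0 0\<close> stands
  for \<open>t\<close> alone; \<open>tpop\<close> does the same for the inverse of
  \<open>t\<close>.\<close>

fun tpush :: "letter list \<Rightarrow> letter list" where
  "tpush (Neg a # w) = (if a = 0 then w else Pos 0 0 # Neg a # w)"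
| "tpush w = Pos 0 0 # w"

fun tpop :: "letter list \<Rightarrow> letter list" where
  "tpop (Pos a k # w) = (if a = 0 \<and> k = 0 then w else Neg 0 # Pos a k # w)"
| "tpop w = Neg 0 # w"

lemma two_powi_eq_1 [simp]: "(2::rat) powi k = 1 \<longleftrightarrow> k = 0"
  using power_int_strict_increasing[of k 0 "2::rat"] power_int_strict_increasing[of 0 k "2::rat"]
  by (cases k "0::int" rule: linorder_cases) auto

lemma reduced_take: "reduced w \<Longrightarrow> reduced (take n w)"
proof (induction w arbitrary: n)
  case (Cons p w)
  have "cancels p (take m w) \<Longrightarrow> cancels p w" for m
    by (cases m; cases "(p, w)" rule: cancels.cases) auto
  with Cons show ?case by (cases n) auto
qed simp

lemma length_hact [simp]: "length (hact b l w) = length w"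
  by (induction b l w rule: hact.induct) (simp_all add: Let_def)

text \<open>The law of the semidirect product. The delicate case is \<open>Pos\<close>: the first
  action splits off an integer \<open>n'\<close>, and adding an integer commutes with the floor, so
  the carries add up.\<close>

lemma hact_hact: "hact b l (hact b' l' w) = hact (b + b' / 2 powi l) (l + l') w"
proof (induction w arbitrary: b l b' l')
  case (Cons p w)
  show ?case
  proof (cases p)
    case (Pos a k)
    define c' where "c' = b' + a / 2 powi l'"
    define n' where "n' = \<lfloor>c' * 2 powi (l' + k)\<rfloor>"
    define a' where "a' = c' - of_int n' / 2 powi (l' + k)"
    define c where "c = b + a' / 2 powi l"
    define n where "n = \<lfloor>c * 2 powi (l + (l' + k))\<rfloor>"
    define d where "d = b + b' / 2 powi l + a / 2 powi (l + l')"
    have d: "d = c + of_int n' / 2 powi (l + (l' + k))"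
      by (simp add: d_def c_def a'_def c'_def field_simps power_int_add)
    then have "d * 2 powi (l + (l' + k)) = c * 2 powi (l + (l' + k)) + of_int n'"
      by (simp add: field_simps)
    then have nd: "\<lfloor>d * 2 powi (l + (l' + k))\<rfloor> = n + n'"
      by (simp add: n_def)
    have "hact b' l' (p # w) = Pos a' (l' + k) # hact 0 n' w"
      by (simp add: Pos Let_def a'_def n'_def c'_def)
    then have "hact b l (hact b' l' (p # w))
        = Pos (c - of_int n / 2 powi (l + (l' + k))) (l + (l' + k)) # hact 0 (n + n') w"
      by (simp add: Let_def Cons flip: c_def n_def)
    also have "c - of_int n / 2 powi (l + (l' + k)) = d - of_int (n + n') / 2 powi (l + (l' + k))"
      by (simp add: d add_divide_distrib)
    also have "Pos \<dots> (l + (l' + k)) # hact 0 (n + n') w = hact (b + b' / 2 powi l) (l + l') (p # w)"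
      unfolding nd[symmetric] by (simp add: Pos Let_def d_def add.assoc)
    finally show ?thesis .
  next
    case (Neg a)
    then show ?thesis by (simp add: Cons field_simps power_int_add)
  qed
qed simp

lemma hact_zero: "reduced w \<Longrightarrow> hact 0 0 w = w"
proof (induction w)
  case (Cons p w)
  show ?case
  proof (cases p)
    case (Pos a k)
    then have "\<lfloor>a * 2 powi k\<rfloor> = 0" using Cons.prems by (simp add: floor_eq_iff)
    then show ?thesis using Cons by (simp add: Pos Let_def)
  qed (use Cons in simp)
qed simp

lemma hact_inverse:
  assumes "reduced w"
  shows "hact (- b * 2 powi l) (- l) (hact b l w) = w"
  using assms by (simp add: hact_hact power_int_minus hact_zero divide_inverse)

lemma hact_reduced:
  assumes "reduced w" "b \<in> dyadic"
  shows "reduced (hact b l w)"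
  using assms
proof (induction w arbitrary: b l)
  case (Cons p w)
  show ?case
  proof (cases p)
    case (Pos a k)
    define c where "c = b + a / 2 powi l"
    define n where "n = \<lfloor>c * 2 powi (l + k)\<rfloor>"
    have "c \<in> dyadic" using Cons.prems by (simp add: c_def Pos dyadic_add dyadic_divide_powi)
    then have "c - of_int n / 2 powi (l + k) \<in> dyadic"
      by (simp add: dyadic_diff dyadic_divide_powi)
    moreover have "of_int n \<le> c * 2 powi (l + k)" "c * 2 powi (l + k) < of_int n + 1"
      unfolding n_def by linarith+
    then have "0 \<le> c - of_int n / 2 powi (l + k)"
      "(c - of_int n / 2 powi (l + k)) * 2 powi (l + k) < 1"
      by (simp_all add: left_diff_distrib divide_le_eq)
    moreover have "\<not> cancels (Pos a' k') (hact 0 n w)" for a' k'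
      using Cons.prems by (cases w; cases "hd w") (auto simp: Pos Let_def)
    ultimately show ?thesis using Cons by (simp add: Pos Let_def flip: c_def n_def)
  next
    case (Neg a)
    \<comment> \<open>The carried power of \<open>x\<close> keeps the exponent \<open>k\<close>. If
      \<open>k = 0\<close>, it changes \<open>d\<close> by an integer, which the floor removes
      again. So a nontrivial coset stays nontrivial.\<close>
    have "\<not> cancels (Neg a') (hact (of_int l) 0 w)" for a'
    proof (cases w)
      case (Cons q w')
      show ?thesis
      proof (cases q)
        case (Pos d k)
        show ?thesis
        proof (cases "k = 0")
          case True
          then have "\<lfloor>d\<rfloor> = 0" "d \<noteq> 0"
            using Cons.prems \<open>reduced (p # w)\<close> by (auto simp: Neg Cons Pos floor_eq_iff)
          then show ?thesis by (simp add: Cons Pos Let_def True)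
        qed (simp add: Cons Pos Let_def)
      qed (simp add: Cons)
    qed simp
    then show ?thesis using Cons by (simp add: Neg dyadic_add dyadic_divide_powi)
  qed
qed simp

text \<open>\<open>hact\<close> works from left to right, so equal prefixes have equal images.
  Applied to the inverse element as well, this makes \<open>hact\<close> an isometry in
  \<open>tdist_hact\<close>.\<close>

lemma lcp_hact_mono: "lcp u v \<le> lcp (hact b l u) (hact b l v)"
proof (induction u v arbitrary: b l rule: lcp.induct)
  case (1 p u q v)
  then show ?case by (cases p) (auto simp: Let_def)
qed auto

lemma tdist_hact:
  assumes "reduced u" "reduced v"
  shows "tdist (hact b l u) (hact b l v) = tdist u v"
proof -
  have "lcp (hact b l u) (hact b l v) = lcp u v"
    using lcp_hact_mono[of u v b l]
      lcp_hact_mono[of "hact b l u" "hact b l v" "- b * 2 powi l" "- l"] assms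
    unfolding hact_inverse[OF assms(1)] hact_inverse[OF assms(2)] by simp
  then show ?thesis by (simp add: tdist_def)
qed

lemma tpush_reduced: "reduced w \<Longrightarrow> reduced (tpush w)"
  by (cases w rule: tpush.cases) auto

lemma tpop_reduced: "reduced w \<Longrightarrow> reduced (tpop w)"
  by (cases w rule: tpop.cases) auto

lemma tpush_not_cancels: "\<not> cancels (Pos a k) w \<Longrightarrow> tpush w = Pos 0 0 # w"
  by (cases w rule: tpush.cases) auto

lemma tpop_not_cancels: "\<not> cancels (Neg a) w \<Longrightarrow> tpop w = Neg 0 # w"
  by (cases w rule: tpop.cases) auto

lemma tpop_tpush: "reduced w \<Longrightarrow> tpop (tpush w) = w"
  by (cases w rule: tpush.cases) (auto simp: tpop_not_cancels)

lemma tpush_tpop: "reduced w \<Longrightarrow> tpush (tpop w) = w"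
  by (cases w rule: tpop.cases) (auto simp: tpush_not_cancels)

text \<open>Unlike \<open>hact\<close>, \<open>tpush\<close> moves the root: words starting with
  \<open>Neg 0\<close> get shorter, all others longer. In the mixed case, isolated as
  \<open>*\<close>, the common prefix is empty before and after.\<close>

lemma tdist_tpush:
  assumes "reduced u" "reduced v"
  shows "tdist (tpush u) (tpush v) = tdist u v"
proof -
  have *: "tdist u' (Pos 0 0 # w) = tdist (Neg 0 # u') w"
    if "reduced (Neg 0 # u')" "\<not> cancels (Pos 0 0) w" for u' w
    using that by (cases "(Neg 0, u')" rule: cancels.cases; cases "(Pos 0 0, w)" rule: cancels.cases)
      (auto simp: tdist_def)
  have split: "(\<exists>w'. w = Neg 0 # w') \<or> \<not> cancels (Pos 0 0) w" for w
    by (cases "(Pos 0 0, w)" rule: cancels.cases) auto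
  from split[of u] split[of v] show ?thesis
  proof (elim disjE exE)
    fix u' v' assume "u = Neg 0 # u'" "v = Neg 0 # v'"
    then show ?thesis by (simp add: tdist_def)
  next
    fix u' assume "u = Neg 0 # u'" "\<not> cancels (Pos 0 0) v"
    then show ?thesis using *[of u' v] assms by (simp add: tpush_not_cancels)
  next
    fix v' assume "v = Neg 0 # v'" "\<not> cancels (Pos 0 0) u"
    then show ?thesis using *[of v' u] assms by (simp add: tpush_not_cancels tdist_commute)
  next
    assume "\<not> cancels (Pos 0 0) u" "\<not> cancels (Pos 0 0) v"
    then show ?thesis by (simp add: tpush_not_cancels tdist_def)
  qed
qed

text \<open>The relation \<open>x t = t y\<close> on words, needed to let the presented group
  act.\<close>

lemma hact_tpush: "reduced w \<Longrightarrow> hact 1 0 (tpush w) = tpush (hact 0 1 w)"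
  by (cases w rule: tpush.cases) (auto simp: Let_def)

section \<open>The group given by its properties, and its vertex subgroup\<close>

lemma (in group) int_pow_intertwine:
  assumes a: "a \<in> carrier G" and b: "b \<in> carrier G" and c: "c \<in> carrier G" and ac: "a \<otimes> c = c \<otimes> b"
  shows "a [^] (m :: int) \<otimes> c = c \<otimes> b [^] m"
proof -
  have hom: "(\<lambda>z. c \<otimes> z \<otimes> inv c) \<in> hom G G"
    using c by (intro homI) (auto simp: m_assoc)
  have "a = c \<otimes> b \<otimes> inv c" using assms by (simp flip: ac add: m_assoc)
  then have "a [^] m = c \<otimes> b [^] m \<otimes> inv c"
    using hom_int_pow[OF hom b group_axioms group_axioms, of m] by simp
  then show ?thesis using b c by (simp add: m_assoc)
qed

text \<open>Collects what the argument takes from the presentation: relations written without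
  inverses, generation, the universal property for endomorphisms, and an action on reduced words
  extending the maps \<open>hact 1 0\<close>, \<open>hact 0 1\<close> and
  \<open>tpush\<close>.\<close>

locale bg_group = group G for G (structure) +
  fixes x y t :: 'a and vact :: "'a \<Rightarrow> letter list \<Rightarrow> letter list"
  assumes x [simp, intro]: "x \<in> carrier G" and y [simp, intro]: "y \<in> carrier G"
    and t [simp, intro]: "t \<in> carrier G"
    and xy: "x \<otimes> y = y \<otimes> (x \<otimes> x)" and xt: "x \<otimes> t = t \<otimes> y"
    and gen: "generate G {x, y, t} = carrier G"
    and endo: "\<And>a b c. a \<in> carrier G \<Longrightarrow> b \<in> carrier G \<Longrightarrow> c \<in> carrier G \<Longrightarrow>
      a \<otimes> b = b \<otimes> (a \<otimes> a) \<Longrightarrow> a \<otimes> c = c \<otimes> b \<Longrightarrow>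
      \<exists>\<phi>\<in>hom G G. \<phi> x = a \<and> \<phi> y = b \<and> \<phi> t = c"
    and vact_reduced: "\<And>g w. g \<in> carrier G \<Longrightarrow> reduced w \<Longrightarrow> reduced (vact g w)"
    and vact_one: "\<And>w. reduced w \<Longrightarrow> vact \<one> w = w"
    and vact_mult: "\<And>g h w. g \<in> carrier G \<Longrightarrow> h \<in> carrier G \<Longrightarrow> reduced w \<Longrightarrow>
      vact (g \<otimes> h) w = vact g (vact h w)"
    and vact_x: "\<And>w. reduced w \<Longrightarrow> vact x w = hact 1 0 w"
    and vact_y: "\<And>w. reduced w \<Longrightarrow> vact y w = hact 0 1 w"
    and vact_t: "\<And>w. reduced w \<Longrightarrow> vact t w = tpush w"
begin

lemma generator_induct [consumes 1, case_names one x x_inv y y_inv t t_inv]: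
  assumes "g \<in> carrier G" and "P \<one>"
    and "\<And>h. h \<in> carrier G \<Longrightarrow> P h \<Longrightarrow> P (x \<otimes> h)" "\<And>h. h \<in> carrier G \<Longrightarrow> P h \<Longrightarrow> P (inv x \<otimes> h)"
    and "\<And>h. h \<in> carrier G \<Longrightarrow> P h \<Longrightarrow> P (y \<otimes> h)" "\<And>h. h \<in> carrier G \<Longrightarrow> P h \<Longrightarrow> P (inv y \<otimes> h)"
    and "\<And>h. h \<in> carrier G \<Longrightarrow> P h \<Longrightarrow> P (t \<otimes> h)" "\<And>h. h \<in> carrier G \<Longrightarrow> P h \<Longrightarrow> P (inv t \<otimes> h)"
  shows "P g"
proof -
  have incl: "generate G {x, y, t} \<subseteq> carrier G" by (simp add: gen)
  have "g \<in> generate G {x, y, t}" using assms(1) by (simp add: gen)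
  \<comment> \<open>The claim is strengthened to all right factors \<open>h\<close>, so that a
    product can be treated one factor at a time.\<close>
  then have "\<forall>h\<in>carrier G. P h \<longrightarrow> P (g \<otimes> h)"
  proof induction
    case (eng h1 h2)
    then show ?case using incl by (auto simp: m_assoc subset_iff)
  qed (use assms(3-) in auto)
  then have "P (g \<otimes> \<one>)" using assms(2) by blast
  then show ?thesis using assms(1) by simp
qed

lemma hom_eqI:
  assumes f: "f \<in> hom G G" and h: "h \<in> hom G G"
    and "f x = h x" "f y = h y" "f t = h t" and g: "g \<in> carrier G"
  shows "f g = h g"
proof -
  interpret f: group_hom G G f using f by unfold_locales
  interpret h: group_hom G G h using h by unfold_locales
  show ?thesis using g by (induction rule: generator_induct) (simp_all add: assms)
qed

text \<open>The power \<open>x^q\<close> for dyadic \<open>q\<close>, read off from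
  \<open>y^i x^m y^-i = x^(m / 2^i)\<close>. The least exponent only fixes a choice;
  \<open>xpow_eq\<close> admits every denominator.\<close>

definition xpow :: "rat \<Rightarrow> 'a" where
  "xpow q = (let i = (LEAST i. q * 2 ^ i \<in> \<int>)
     in y [^] i \<otimes> x [^] \<lfloor>q * 2 ^ i\<rfloor> \<otimes> inv (y [^] i))"

definition iota :: "rat \<Rightarrow> int \<Rightarrow> 'a" where
  "iota a k = xpow a \<otimes> y [^] k"

lemma xpow_closed [simp, intro]: "xpow q \<in> carrier G"
  by (simp add: xpow_def Let_def)

lemma iota_closed [simp, intro]: "iota a k \<in> carrier G"
  by (simp add: iota_def)

lemma x_int_pow_y: "x [^] (m :: int) \<otimes> y = y \<otimes> x [^] (2 * m)"
proof -
  have "x [^] (2::int) = x \<otimes> x"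
    using int_pow_mult[of x 1 1] by simp
  then have "(x \<otimes> x) [^] m = x [^] (2 * m)"
    using int_pow_pow[of x 2 m] by (simp add: mult.commute)
  then show ?thesis using int_pow_intertwine[OF x _ y xy, of m] by simp
qed

lemma x_int_pow_t: "x [^] (m :: int) \<otimes> t = t \<otimes> y [^] m"
  by (rule int_pow_intertwine) (simp_all add: xt)

lemma xpow_shift:
  "y [^] i \<otimes> x [^] (m :: int) \<otimes> inv (y [^] i)
    = y [^] (i + j) \<otimes> x [^] (m * 2 ^ j) \<otimes> inv (y [^] (i + j))" for i j :: nat
proof (induction j)
  case (Suc j)
  have "x [^] (m * 2 ^ j) = y \<otimes> x [^] (2 * (m * 2 ^ j)) \<otimes> inv y"
    by (simp add: m_assoc flip: x_int_pow_y)
  with Suc show ?case by (simp add: m_assoc inv_mult_group ac_simps)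
qed simp

lemma xpow_eq:
  assumes "q = of_int m / 2 ^ i"
  shows "xpow q = y [^] i \<otimes> x [^] m \<otimes> inv (y [^] i)"
proof -
  define j where "j = (LEAST i. q * 2 ^ i \<in> \<int>)"
  have "q * 2 ^ i = of_int m" using assms by simp
  then have i: "q * 2 ^ i \<in> \<int>" by simp
  then have "q * 2 ^ j \<in> \<int>" unfolding j_def by (rule LeastI)
  then obtain n where n: "q * 2 ^ j = of_int n" by (auto elim: Ints_cases)
  obtain d where d: "i = j + d" using Least_le[of "\<lambda>i. q * 2 ^ i \<in> \<int>", OF i] le_Suc_ex unfolding j_def by blast
  have "of_int m = (of_int (n * 2 ^ d) :: rat)"
    using n assms by (simp add: d power_add field_simps flip: n)
  then have "m = n * 2 ^ d" by (simp only: of_int_eq_iff)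
  moreover have "xpow q = y [^] j \<otimes> x [^] n \<otimes> inv (y [^] j)"
    by (simp add: xpow_def n flip: j_def)
  ultimately show ?thesis using xpow_shift[of j n d] by (simp add: d)
qed

lemma xpow_of_int [simp]: "xpow (of_int m) = x [^] m"
  using xpow_eq[of "of_int m" m 0] by simp

lemma xpow_0 [simp]: "xpow 0 = \<one>" and xpow_1 [simp]: "xpow 1 = x"
  using xpow_of_int[of 0] xpow_of_int[of 1] by simp_all

lemma xpow_add:
  assumes "a \<in> dyadic" "b \<in> dyadic"
  shows "xpow (a + b) = xpow a \<otimes> xpow b"
proof -
  obtain m i where a: "a = of_int m / 2 ^ i" using assms by (elim dyadicE)
  obtain n j where b: "b = of_int n / 2 ^ j" using assms by (elim dyadicE)
  have "xpow a = y [^] (i + j) \<otimes> x [^] (m * 2 ^ j) \<otimes> inv (y [^] (i + j))"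
    by (rule xpow_eq) (simp add: a power_add)
  moreover have "xpow b = y [^] (i + j) \<otimes> x [^] (n * 2 ^ i) \<otimes> inv (y [^] (i + j))"
    by (rule xpow_eq) (simp add: b power_add)
  moreover have "xpow (a + b) = y [^] (i + j) \<otimes> x [^] (m * 2 ^ j + n * 2 ^ i) \<otimes> inv (y [^] (i + j))"
    by (rule xpow_eq) (simp add: a b power_add add_divide_distrib)
  ultimately show ?thesis
    by (simp add: m_assoc int_pow_mult del: nat_pow_mult)
qed

lemma y_xpow:
  assumes "b \<in> dyadic"
  shows "y \<otimes> xpow b = xpow (b / 2) \<otimes> y"
proof -
  obtain m i where b: "b = of_int m / 2 ^ i" using assms by (elim dyadicE)
  have "xpow (b / 2) = y [^] Suc i \<otimes> x [^] m \<otimes> inv (y [^] Suc i)"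
    by (rule xpow_eq) (simp add: b)
  then show ?thesis unfolding nat_pow_Suc2[OF y] xpow_eq[OF b]
    by (simp add: inv_mult_group m_assoc)
qed

lemma y_int_pow_xpow: "b \<in> dyadic \<Longrightarrow> y [^] (k :: int) \<otimes> xpow b = xpow (b / 2 powi k) \<otimes> y [^] k"
proof (induction k arbitrary: b rule: int_induct[where k = 0])
  case (step1 k)
  have "y [^] (k + 1) \<otimes> xpow b = y [^] k \<otimes> (y \<otimes> xpow b)"
    by (simp add: int_pow_mult m_assoc)
  also have "\<dots> = (y [^] k \<otimes> xpow (b / 2)) \<otimes> y"
    using step1 by (simp add: y_xpow m_assoc)
  also have "\<dots> = xpow (b / 2 / 2 powi k) \<otimes> y [^] (k + 1)"
    using step1.IH[of "b / 2"] step1.prems dyadic_divide_powi[of b 1]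
    by (simp add: int_pow_mult m_assoc)
  finally show ?case by (simp add: power_int_add mult.commute)
next
  case (step2 k)
  have d: "2 * b \<in> dyadic" using dyadic_mult_powi[OF step2.prems, of 1] by (simp add: mult.commute)
  have "xpow (2 * b) \<otimes> inv y = inv y \<otimes> (y \<otimes> xpow (2 * b)) \<otimes> inv y" by simp
  also have "\<dots> = inv y \<otimes> xpow b"
    unfolding y_xpow[OF d] by (simp add: m_assoc)
  finally have y1: "inv y \<otimes> xpow b = xpow (2 * b) \<otimes> inv y" ..
  have p: "y [^] (k - 1) = y [^] k \<otimes> inv y"
    by (simp add: int_pow_diff)
  have "y [^] (k - 1) \<otimes> xpow b = (y [^] k \<otimes> xpow (2 * b)) \<otimes> inv y"
    by (simp add: p m_assoc y1)
  also have "\<dots> = xpow (2 * b / 2 powi k) \<otimes> y [^] (k - 1)"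
    using step2.IH[OF d] by (simp add: p m_assoc)
  finally show ?case by (simp add: power_int_diff mult.commute)
qed simp

lemma iota_mult:
  assumes "a \<in> dyadic" "b \<in> dyadic"
  shows "iota a k \<otimes> iota b l = iota (a + b / 2 powi k) (k + l)"
proof -
  have "iota a k \<otimes> iota b l = xpow a \<otimes> (y [^] k \<otimes> xpow b) \<otimes> y [^] l"
    by (simp add: iota_def m_assoc)
  also have "\<dots> = xpow a \<otimes> (xpow (b / 2 powi k) \<otimes> y [^] k) \<otimes> y [^] l"
    by (simp add: y_int_pow_xpow assms)
  finally show ?thesis
    using assms by (simp add: iota_def m_assoc xpow_add dyadic_divide_powi int_pow_mult)
qed

lemma iota_simps [simp]: "iota a 0 = xpow a" "iota 0 k = y [^] k"
  by (simp_all add: iota_def)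

lemma vact_inv:
  assumes "g \<in> carrier G" "reduced w" "reduced v" "vact g w = v"
  shows "vact (inv g) v = w"
  using assms vact_mult[of "inv g" g w] by (simp add: vact_one)

lemma vact_inv_y: "reduced w \<Longrightarrow> vact (inv y) w = hact 0 (- 1) w"
  by (rule vact_inv) (simp_all add: hact_reduced vact_y hact_hact hact_zero)

lemma vact_inv_x: "reduced w \<Longrightarrow> vact (inv x) w = hact (- 1) 0 w"
  by (rule vact_inv) (simp_all add: hact_reduced vact_x hact_hact hact_zero dyadic_minus)

lemma vact_inv_t: "reduced w \<Longrightarrow> vact (inv t) w = tpop w"
  by (rule vact_inv) (simp_all add: tpop_reduced vact_t tpush_tpop)

lemma vact_x_int_pow: "reduced w \<Longrightarrow> vact (x [^] (m :: int)) w = hact (of_int m) 0 w"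
proof (induction m arbitrary: w rule: int_induct[where k = 0])
  case (step1 m)
  then show ?case by (simp add: int_pow_mult vact_mult vact_x hact_reduced hact_hact add.commute)
next
  case (step2 m)
  then show ?case by (simp add: int_pow_diff vact_mult vact_inv_x hact_reduced hact_hact dyadic_minus)
qed (simp add: vact_one hact_zero)

lemma vact_y_int_pow: "reduced w \<Longrightarrow> vact (y [^] (k :: int)) w = hact 0 k w"
proof (induction k arbitrary: w rule: int_induct[where k = 0])
  case (step1 m)
  then show ?case by (simp add: int_pow_mult vact_mult vact_y hact_reduced hact_hact add.commute)
next
  case (step2 m)
  then show ?case by (simp add: int_pow_diff vact_mult vact_inv_y hact_reduced hact_hact)
qed (simp add: vact_one hact_zero)

lemma vact_iota:
  assumes "a \<in> dyadic" "reduced w"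
  shows "vact (iota a k) w = hact a k w"
proof -
  have *: "vact (xpow a) w = hact a 0 w" if "reduced w" for w
  proof -
    obtain m i where a: "a = of_int m / 2 ^ i" using assms by (elim dyadicE)
    have "xpow a = y [^] int i \<otimes> (x [^] m \<otimes> y [^] (- int i))"
      by (simp add: xpow_eq[OF a] m_assoc int_pow_neg int_pow_int)
    then show ?thesis using that
      by (simp add: vact_mult vact_reduced vact_x_int_pow vact_y_int_pow hact_reduced hact_hact a)
  qed
  show ?thesis using assms
    by (simp add: iota_def vact_mult vact_y_int_pow * hact_reduced hact_hact)
qed

text \<open>The tree detects both coordinates: \<open>[Neg 0]\<close> is moved to
  \<open>[Neg a]\<close>, and \<open>k\<close> shows in the image of \<open>[Pos 0 0]\<close>. So
  the semidirect product embeds in \<open>G\<close>.\<close>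

lemma iota_inj:
  assumes "iota a k = iota b l" "a \<in> dyadic" "b \<in> dyadic"
  shows "a = b" "k = l"
  using vact_iota[OF assms(2), of "[Neg 0]" k] vact_iota[OF assms(3), of "[Neg 0]" l]
    vact_iota[OF assms(2), of "[Pos 0 0]" k] vact_iota[OF assms(3), of "[Pos 0 0]" l] assms(1)
  by (simp_all add: Let_def)

section \<open>Normal forms and the stabiliser of the root\<close>

primrec letter_elem :: "letter \<Rightarrow> 'a" where
  "letter_elem (Pos a k) = iota a k \<otimes> t"
| "letter_elem (Neg a) = xpow a \<otimes> inv t"

primrec word_elem :: "letter list \<Rightarrow> 'a" where
  "word_elem [] = \<one>"
| "word_elem (p # w) = letter_elem p \<otimes> word_elem w"

lemma word_elem_closed [simp, intro]: "word_elem w \<in> carrier G"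
proof (induction w)
  case (Cons p w)
  then show ?case by (cases p) auto
qed simp

text \<open>No cancellation occurs while a reduced word is built up from its right end, so each
  letter is just put in front. This yields transitivity of the action and identifies the word of a
  normal form.\<close>

lemma vact_word_elem: "reduced w \<Longrightarrow> vact (word_elem w) [] = w"
proof (induction w)
  case (Cons p w)
  show ?case
  proof (cases p)
    case (Pos a k)
    then have "\<lfloor>a * 2 powi k\<rfloor> = 0" using Cons.prems by (simp add: floor_eq_iff)
    moreover have "tpush w = Pos 0 0 # w" "reduced (tpush w)"
      using Cons.prems by (auto simp: Pos intro: tpush_not_cancels tpush_reduced)
    ultimately show ?thesis using Cons
      by (simp add: Pos vact_mult vact_reduced vact_iota vact_t hact_zero Let_def m_assoc)
  next
    case (Neg a)
    moreover have "tpop w = Neg 0 # w" "reduced (tpop w)"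
      using Cons.prems by (auto simp: Neg intro: tpop_not_cancels tpop_reduced)
    ultimately show ?thesis using Cons vact_iota[of a _ 0]
      by (simp add: vact_mult vact_reduced vact_inv_t hact_zero m_assoc)
  qed
qed (simp add: vact_one)

text \<open>The counterpart of \<open>hact\<close> in the group: an element of the vertex group
  moves through the word by the same carries, and what comes out at the right end lies in the vertex
  group again.\<close>

lemma iota_word_elem:
  assumes "reduced w" "b \<in> dyadic"
  shows "\<exists>c\<in>dyadic. \<exists>k. iota b l \<otimes> word_elem w = word_elem (hact b l w) \<otimes> iota c k"
  using assms
proof (induction w arbitrary: b l)
  case Nil
  then show ?case by (intro bexI[of _ b] exI[of _ l]) simp_all
next
  case (Cons p w)
  show ?case
  proof (cases p)
    case (Pos a k)
    define c where "c = b + a / 2 powi l"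
    define s where "s = l + k"
    define n where "n = \<lfloor>c * 2 powi s\<rfloor>"
    have a: "a \<in> dyadic" using Cons.prems by (simp add: Pos)
    have c: "c \<in> dyadic" using Cons.prems a by (simp add: c_def dyadic_add dyadic_divide_powi)
    obtain e j where e: "e \<in> dyadic" "iota 0 n \<otimes> word_elem w = word_elem (hact 0 n w) \<otimes> iota e j"
      using Cons.IH[of 0 n] Cons.prems by auto
    have "iota c s = iota (c - of_int n / 2 powi s) s \<otimes> iota (of_int n) 0"
      using c by (simp only: iota_mult dyadic_diff dyadic_divide_powi dyadic_of_int) simp
    then have "iota c s \<otimes> t = iota (c - of_int n / 2 powi s) s \<otimes> t \<otimes> iota 0 n"
      by (simp add: m_assoc x_int_pow_t)
    moreover have "iota b l \<otimes> iota a k = iota c s"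
      using Cons.prems a by (simp add: iota_mult c_def s_def)
    then have "iota b l \<otimes> word_elem (p # w) = (iota c s \<otimes> t) \<otimes> word_elem w"
      by (simp add: Pos flip: m_assoc)
    ultimately have "iota b l \<otimes> word_elem (p # w)
        = iota (c - of_int n / 2 powi s) s \<otimes> t \<otimes> (iota 0 n \<otimes> word_elem w)"
      by (simp add: m_assoc)
    also have "\<dots> = word_elem (hact b l (p # w)) \<otimes> iota e j"
      unfolding e(2) by (simp add: Pos Let_def m_assoc c_def s_def n_def)
    finally show ?thesis using e(1) by blast
  next
    case (Neg a)
    define c where "c = b + a / 2 powi l"
    have a: "a \<in> dyadic" using Cons.prems by (simp add: Neg)
    have c: "c \<in> dyadic" using Cons.prems a by (simp add: c_def dyadic_add dyadic_divide_powi)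
    obtain e j where e: "e \<in> dyadic"
      "iota (of_int l) 0 \<otimes> word_elem w = word_elem (hact (of_int l) 0 w) \<otimes> iota e j"
      using Cons.IH[of "of_int l" 0] Cons.prems by auto
    have "y [^] l \<otimes> inv t = inv t \<otimes> (t \<otimes> y [^] l) \<otimes> inv t" by simp
    also have "\<dots> = inv t \<otimes> x [^] l"
      unfolding x_int_pow_t[symmetric] by (simp add: m_assoc)
    finally have yt: "y [^] l \<otimes> inv t = inv t \<otimes> x [^] l" .
    have "iota b l \<otimes> xpow a = xpow c \<otimes> y [^] l"
      using iota_mult[OF Cons.prems(2) a, of l 0] by (simp add: c_def) (simp add: iota_def)
    then have "iota b l \<otimes> word_elem (p # w) = xpow c \<otimes> (y [^] l \<otimes> inv t) \<otimes> word_elem w"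
      by (simp add: Neg flip: m_assoc)
    also have "\<dots> = xpow c \<otimes> inv t \<otimes> (iota (of_int l) 0 \<otimes> word_elem w)"
      unfolding yt by (simp add: m_assoc)
    also have "\<dots> = word_elem (hact b l (p # w)) \<otimes> iota e j"
      unfolding e(2) by (simp add: Neg m_assoc c_def)
    finally show ?thesis using e(1) by blast
  qed
qed

lemma t_word_elem: "t \<otimes> word_elem w = word_elem (tpush w)"
  by (cases w rule: tpush.cases) (auto simp: m_assoc)

lemma inv_t_word_elem: "inv t \<otimes> word_elem w = word_elem (tpop w)"
  by (cases w rule: tpop.cases) (auto simp: m_assoc)

text \<open>The normal form in an HNN extension. Products of this shape include
  \<open>\<one>\<close> and are closed under left multiplication by generators and their inverses:
  \<open>iota_word_elem\<close> handles \<open>x\<close> and \<open>y\<close>, while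
  \<open>tpush\<close> and \<open>tpop\<close> handle \<open>t\<close>.\<close>

lemma normal_form:
  assumes "g \<in> carrier G"
  shows "\<exists>w a k. reduced w \<and> a \<in> dyadic \<and> g = word_elem w \<otimes> iota a k"
  using assms
proof (induction rule: generator_induct)
  case one
  then show ?case by (intro exI[of _ "[]"] exI[of _ 0]) simp
next
  have H: "\<exists>w a k. reduced w \<and> a \<in> dyadic \<and> iota b l \<otimes> h = word_elem w \<otimes> iota a k"
    if b: "b \<in> dyadic" and h: "\<exists>w a k. reduced w \<and> a \<in> dyadic \<and> h = word_elem w \<otimes> iota a k" for b l h
  proof -
    obtain w a k where w: "reduced w" "a \<in> dyadic" "h = word_elem w \<otimes> iota a k" using h by blast
    obtain c j where c: "c \<in> dyadic" "iota b l \<otimes> word_elem w = word_elem (hact b l w) \<otimes> iota c j"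
      using iota_word_elem[OF w(1) b] by blast
    have "iota b l \<otimes> h = iota b l \<otimes> word_elem w \<otimes> iota a k" by (simp add: w m_assoc)
    also have "\<dots> = word_elem (hact b l w) \<otimes> iota (c + a / 2 powi j) (j + k)"
      by (simp add: c m_assoc iota_mult w)
    finally show ?thesis
      using hact_reduced[OF w(1) b] dyadic_add[OF c(1) dyadic_divide_powi[OF w(2)]] by blast
  qed
  { case (x h) then show ?case using H[of 1 h 0] by simp }
  { case (x_inv h) then show ?case using H[of "- 1" h 0] xpow_of_int[of "- 1"]
      by (simp add: int_pow_neg dyadic_minus) }
  { case (y h) then show ?case using H[of 0 h 1] by simp }
  { case (y_inv h) then show ?case using H[of 0 h "- 1"] by (simp add: int_pow_neg) }
  { case (t h) then show ?case
      by (metis t_word_elem tpush_reduced m_assoc word_elem_closed iota_closed bg_group.t bg_group_axioms) }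
  { case (t_inv h) then show ?case
      by (metis inv_t_word_elem tpop_reduced m_assoc word_elem_closed iota_closed bg_group.t bg_group_axioms inv_closed) }
qed

lemma normal_form_vact:
  assumes "g \<in> carrier G"
  obtains a k where "a \<in> dyadic" "g = word_elem (vact g []) \<otimes> iota a k"
proof -
  obtain w a k where w: "reduced w" "a \<in> dyadic" "g = word_elem w \<otimes> iota a k"
    using normal_form[OF assms] by blast
  then have "vact g [] = w" by (simp add: vact_mult vact_iota vact_word_elem)
  then show thesis using that w by blast
qed

text \<open>The word in the normal form of \<open>g\<close> is the image of the root, which is empty
  here.\<close>

lemma stabilizer_root:
  assumes "g \<in> carrier G" "vact g [] = []"
  obtains a k where "a \<in> dyadic" "g = iota a k"
proof -
  obtain a k where a: "a \<in> dyadic" "g = word_elem (vact g []) \<otimes> iota a k"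
    by (rule normal_form_vact[OF assms(1)])
  have "g = iota a k" using a(2) unfolding assms(2) by simp
  with a(1) show thesis by (rule that)
qed

lemma tdist_vact:
  assumes "g \<in> carrier G"
  shows "reduced u \<Longrightarrow> reduced v \<Longrightarrow> tdist (vact g u) (vact g v) = tdist u v"
  using assms
proof (induction rule: generator_induct)
  case (t_inv h)
  have "tdist (tpop a) (tpop b) = tdist a b" if "reduced a" "reduced b" for a b
    using tdist_tpush[of "tpop a" "tpop b"] that by (simp add: tpush_tpop tpop_reduced)
  with t_inv show ?case by (simp add: vact_mult vact_reduced vact_inv_t)
qed (simp_all add: vact_one vact_mult vact_reduced vact_x vact_y vact_inv_x vact_inv_y vact_t
    tdist_hact tdist_tpush)

sublocale tree: rooted_tree_action G "{w. reduced w}" vact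
proof
  fix v assume "v \<in> {w. reduced w}"
  then show "\<exists>g\<in>carrier G. vact g [] = v"
    by (intro bexI[of _ "word_elem v"]) (simp_all add: vact_word_elem)
qed (simp_all add: vact_reduced vact_one vact_mult tdist_vact reduced_take)

text \<open>In the tree, the fixed vertices of \<open>x\<^sup>m\<close> form a star around the root, so whatever
  conjugates \<open>x\<^sup>m\<close> to \<open>x\<close> lies in the vertex group.\<close>

lemma odd_x_power_conj:
  assumes c: "c \<in> carrier G" and m: "odd m" and eq: "x [^] (m :: int) \<otimes> c = c \<otimes> x"
  shows "m = 1 \<and> (\<exists>q\<in>dyadic. c = xpow q)"
proof -
  define w where "w = vact c []"
  have w: "reduced w" using c by (simp add: w_def vact_reduced)
  obtain a k where a: "a \<in> dyadic" and cw: "c = word_elem w \<otimes> iota a k"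
    using normal_form_vact[OF c] unfolding w_def by blast
  \<comment> \<open>\<open>x\<close> fixes the root, so \<open>x^m\<close> fixes \<open>w\<close>,
    the image of the root under \<open>c\<close>.\<close>
  have "vact (x [^] m) w = vact (c \<otimes> x) []"
    using c by (simp add: w_def vact_mult flip: eq)
  then have fix_w: "hact (of_int m) 0 w = w"
    using c w by (simp add: vact_x_int_pow vact_mult vact_x flip: w_def)
  show ?thesis
  proof (cases w)
    \<comment> \<open>Inside the vertex group the exponents of \<open>x\<close> give
      \<open>m * 2^k = 1\<close>, and the oddness of \<open>m\<close> excludes a negative
      \<open>k\<close>.\<close>
    case Nil
    then have ck: "c = iota a k" by (simp add: cw)
    have "iota (of_int m) 0 \<otimes> iota a k = iota a k \<otimes> iota 1 0" using eq by (simp add: ck)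
    then have "iota (of_int m + a) k = iota (a + 1 / 2 powi k) k"
      using a by (simp only: iota_mult dyadic_of_int dyadic_1) simp
    then have "of_int m + a = a + 1 / 2 powi k"
      by (rule iota_inj(1)) (simp_all add: a dyadic_add dyadic_divide_powi)
    then have mk: "of_int m * 2 powi k = (1 :: rat)" by (simp add: field_simps)
    have "k = 0"
    proof (cases k "0::int" rule: linorder_cases)
      case less
      then have "of_int m = (2 :: rat) ^ nat (- k)"
        using mk by (simp add: power_int_def field_simps)
      then have "of_int m = (of_int (2 ^ nat (- k)) :: rat)" by simp
      then have "m = 2 ^ nat (- k)" by (simp only: of_int_eq_iff)
      then show ?thesis using m less by simp
    next
      case greater
      then have "of_int (m * 2 ^ nat k) = (of_int 1 :: rat)"
        using mk by (simp add: power_int_def)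
      then have "m * 2 ^ nat k = 1" by (simp only: of_int_eq_iff)
      then have "even (1 :: int)" using greater by (metis dvd_mult dvd_power zero_less_nat_eq)
      then show ?thesis by simp
    qed
    then show ?thesis using mk a ck by auto
  next
    case (Cons p w')
    have "m \<noteq> 0" using m by auto
    show ?thesis
    proof (cases p)
      \<comment> \<open>The action of \<open>x^m\<close> would add \<open>m\<close> to
        \<open>b\<close>.\<close>
      case (Neg b)
      then show ?thesis using fix_w \<open>m \<noteq> 0\<close> by (simp add: Cons)
    next
      case (Pos b j)
      define n where "n = \<lfloor>(of_int m + b) * 2 powi j\<rfloor>"
      have fix': "of_int m + b - of_int n / 2 powi j = b" "hact 0 n w' = w'"
        using fix_w by (auto simp: Cons Pos Let_def n_def)
      then have mn: "of_int m = of_int n / (2 :: rat) powi j" by simp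
      then have "n \<noteq> 0" using \<open>m \<noteq> 0\<close> by auto
      have b: "b \<in> dyadic" using w by (simp add: Cons Pos)
      show ?thesis
      proof (cases w')
        \<comment> \<open>Moved through \<open>iota b j\<close> and \<open>t\<close>, the power
          \<open>x^m\<close> becomes \<open>y^n\<close>, which \<open>iota a k\<close> would have to
          conjugate to \<open>x\<close>; the exponents of \<open>y\<close> then force
          \<open>n = 0\<close>.\<close>
        case Nil
        have ck: "c = iota b j \<otimes> t \<otimes> iota a k" by (simp add: cw Cons Pos Nil)
        have "iota (of_int m) 0 \<otimes> iota b j = iota b j \<otimes> iota (of_int n) 0"
          using b by (simp only: iota_mult dyadic_of_int) (simp add: mn add.commute)
        then have "x [^] m \<otimes> iota b j = iota b j \<otimes> x [^] n" by simp
        then have "x [^] m \<otimes> c = iota b j \<otimes> (x [^] n \<otimes> t) \<otimes> iota a k"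
          by (simp add: ck flip: m_assoc)
        also have "\<dots> = iota b j \<otimes> t \<otimes> (iota 0 n \<otimes> iota a k)"
          by (simp add: x_int_pow_t m_assoc)
        finally have "iota 0 n \<otimes> iota a k = iota a k \<otimes> iota 1 0"
          unfolding eq by (simp add: ck m_assoc)
        then have "iota (a / 2 powi n) (n + k) = iota (a + 1 / 2 powi k) k"
          using a by (simp only: iota_mult dyadic_0 dyadic_1) simp
        then have "n + k = k"
          by (rule iota_inj(2)) (simp_all add: a dyadic_add dyadic_divide_powi)
        then show ?thesis using \<open>n \<noteq> 0\<close> by simp
      next
        \<comment> \<open>\<open>y^n\<close> would have to fix \<open>w'\<close>. It changes the
          exponent of \<open>y\<close> in a \<open>Pos\<close> letter and scales the rational in a
          \<open>Neg\<close> letter, which leaves only \<open>Neg 0\<close>, and that cancels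
          against \<open>p\<close>.\<close>
        case (Cons q w'')
        show ?thesis
        proof (cases q)
          case (Pos d i)
          then show ?thesis using fix'(2) \<open>n \<noteq> 0\<close> by (simp add: Cons Let_def)
        next
          case (Neg d)
          then have "d / 2 powi n = d" using fix'(2) by (simp add: Cons)
          then have "d = 0" using \<open>n \<noteq> 0\<close> by (simp add: divide_eq_eq)
          then show ?thesis using w by (simp add: \<open>w = p # w'\<close> Cons Neg \<open>p = Pos b j\<close>)
        qed
      qed
    qed
  qed
qed

end

section \<open>Outer automorphisms\<close>

lemma int_odd_decomposition: "m \<noteq> 0 \<Longrightarrow> \<exists>e n. m = 2 ^ e * n \<and> odd (n :: int)"
proof (induction "nat \<bar>m\<bar>" arbitrary: m rule: less_induct)
  case less
  show ?case
  proof (cases "odd m")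
    case True
    then show ?thesis by (intro exI[of _ 0] exI[of _ m]) simp
  next
    case False
    then obtain k where k: "m = 2 * k" by (auto elim: evenE)
    then obtain e n where "k = 2 ^ e * n" "odd n" 
      using less.hyps[of k] less.prems by (auto simp: abs_mult nat_mono_iff)
    then show ?thesis using k by (intro exI[of _ "Suc e"] exI[of _ n]) simp
  qed
qed

lemma dyadic_odd_multiple:
  assumes "a \<in> dyadic" "a \<noteq> 0"
  obtains k :: int and m :: int where "odd m" "a * 2 powi k = of_int m"
proof -
  obtain n i where a: "a = of_int n / 2 ^ i" using assms(1) by (elim dyadicE)
  then have "n \<noteq> 0" using assms(2) by auto
  then obtain e m where m: "n = 2 ^ e * m" "odd m" using int_odd_decomposition by blast
  have "a * 2 powi (int i - int e) = of_int m" by (simp add: a m power_int_diff)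
  with m(2) show thesis by (rule that)
qed

lemma (in group) conj_by_hom: "u \<in> carrier G \<Longrightarrow> (\<lambda>z. conj_by G z u) \<in> hom G G"
  by (intro homI) (simp_all add: conj_by_def m_assoc)

lemma (in group) conj_by_closed [simp]:
  "z \<in> carrier G \<Longrightarrow> u \<in> carrier G \<Longrightarrow> conj_by G z u \<in> carrier G"
  by (simp add: conj_by_def)

lemma (in group) conj_by_mult:
  "z \<in> carrier G \<Longrightarrow> u \<in> carrier G \<Longrightarrow> v \<in> carrier G \<Longrightarrow>
    conj_by G z (u \<otimes> v) = conj_by G (conj_by G z u) v"
  by (simp add: conj_by_def m_assoc inv_mult_group)

lemma (in group) conj_by_eqI:
  assumes "z \<otimes> u = u \<otimes> v" "u \<in> carrier G" "v \<in> carrier G" "z \<in> carrier G"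
  shows "conj_by G z u = v"
  using assms by (simp add: conj_by_def m_assoc)

lemma (in group) mult_conj_by: "u \<in> carrier G \<Longrightarrow> z \<in> carrier G \<Longrightarrow> u \<otimes> conj_by G z u = z \<otimes> u"
  by (simp add: conj_by_def m_assoc)

lemma mult_AutoGroup:
  "f \<in> auto G \<Longrightarrow> h \<in> auto G \<Longrightarrow> f \<otimes>\<^bsub>AutoGroup G\<^esub> h = compose (carrier G) f h"
  by (simp add: AutoGroup_def BijGroup_def auto_def)

lemma carrier_AutoGroup: "carrier (AutoGroup G) = auto G"
  by (simp add: AutoGroup_def)

section \<open>Twists of the stable letter\<close>

context bg_group
begin

text \<open>The restriction makes the map extensional, as members of \<open>auto G\<close> must
  be.\<close>

definition twist :: "rat \<Rightarrow> 'a \<Rightarrow> 'a" where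
  "twist q = restrict (SOME \<phi>. \<phi> \<in> hom G G \<and> \<phi> x = x \<and> \<phi> y = y \<and> \<phi> t = xpow q \<otimes> t) (carrier G)"

lemma twist_props:
  assumes q: "q \<in> dyadic"
  shows "twist q \<in> hom G G" "twist q x = x" "twist q y = y" "twist q t = xpow q \<otimes> t"
proof -
  have "x \<otimes> xpow q = xpow q \<otimes> x"
    using xpow_add[of 1 q] xpow_add[of q 1] q by (simp add: add.commute)
  then have "x \<otimes> (xpow q \<otimes> t) = xpow q \<otimes> (x \<otimes> t)" by (simp flip: m_assoc)
  then have "x \<otimes> (xpow q \<otimes> t) = (xpow q \<otimes> t) \<otimes> y" by (simp add: xt m_assoc)
  then have "\<exists>\<phi>. \<phi> \<in> hom G G \<and> \<phi> x = x \<and> \<phi> y = y \<and> \<phi> t = xpow q \<otimes> t"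
    using endo[of x y "xpow q \<otimes> t"] xy by auto
  from someI_ex[OF this] show "twist q \<in> hom G G" "twist q x = x" "twist q y = y" "twist q t = xpow q \<otimes> t"
    unfolding twist_def by (auto simp: hom_def Pi_def)
qed

lemma twist_closed: "q \<in> dyadic \<Longrightarrow> g \<in> carrier G \<Longrightarrow> twist q g \<in> carrier G"
  using twist_props(1) by (rule hom_in_carrier)

lemma twist_xpow: "q \<in> dyadic \<Longrightarrow> twist q (xpow r) = xpow r"
proof -
  assume q: "q \<in> dyadic"
  interpret h: group_hom G G "twist q" using twist_props(1)[OF q] by unfold_locales
  show ?thesis by (simp add: xpow_def Let_def h.hom_nat_pow h.hom_int_pow twist_props q)
qed

text \<open>It suffices to compare on the generators. As \<open>twist q\<close> fixes
  \<open>xpow r\<close>, the composition sends \<open>t\<close> to \<open>x^r x^q t\<close>.\<close>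

lemma twist_twist:
  assumes "q \<in> dyadic" "r \<in> dyadic" "g \<in> carrier G"
  shows "twist q (twist r g) = twist (q + r) g"
proof -
  have "(twist q \<circ> twist r) g = twist (q + r) g"
  proof (rule hom_eqI[of "twist q \<circ> twist r" "twist (q + r)"])
    show "twist q \<circ> twist r \<in> hom G G"
      using Group.hom_compose[OF twist_props(1) twist_props(1)] assms by blast
    have "twist q (xpow r \<otimes> t) = xpow r \<otimes> (xpow q \<otimes> t)"
      using hom_mult[OF twist_props(1)[OF assms(1)], of "xpow r" t]
      by (simp add: twist_xpow twist_props assms)
    then show "(twist q \<circ> twist r) t = twist (q + r) t"
      using xpow_add[OF assms(2,1)] by (simp add: twist_props assms dyadic_add m_assoc add.commute)
  qed (simp_all add: twist_props assms dyadic_add)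
  then show ?thesis by simp
qed

lemma twist_0: "g \<in> carrier G \<Longrightarrow> twist 0 g = g"
  by (rule hom_eqI[of _ "\<lambda>z. z"]) (auto simp: twist_props intro: homI)

lemma twist_auto:
  assumes q: "q \<in> dyadic"
  shows "twist q \<in> auto G"
proof -
  have "bij_betw (twist q) (carrier G) (carrier G)"
    by (rule bij_betw_byWitness[where f' = "twist (- q)"])
      (use q in \<open>auto simp: twist_twist twist_0 twist_closed dyadic_minus\<close>)
  then show ?thesis using twist_props(1)[OF q] by (simp add: auto_def Bij_def twist_def)
qed

lemma twist_mult:
  assumes "q \<in> dyadic" "r \<in> dyadic"
  shows "twist q \<otimes>\<^bsub>AutoGroup G\<^esub> twist r = twist (q + r)"
  using assms
  by (auto simp: mult_AutoGroup twist_auto twist_twist compose_def fun_eq_iff)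
    (simp add: twist_def)

text \<open>The conjugating element \<open>g\<close> commutes with \<open>x\<close> and
  \<open>y\<close>. The first gives \<open>g = x^r\<close>, the second \<open>r / 2 = r\<close>;
  hence \<open>g\<close> is trivial and \<open>t\<close> is fixed.\<close>

lemma twist_inner:
  assumes q: "q \<in> dyadic" and inn: "twist q \<in> Inn G"
  shows "q = 0"
proof -
  obtain g where g: "g \<in> carrier G" "twist q = (\<lambda>a\<in>carrier G. conj_by G a g)"
    using inn by (auto simp: Inn_def)
  have comm: "a \<otimes> g = g \<otimes> twist q a" if "a \<in> carrier G" for a
    using that g by (simp add: conj_by_def m_assoc)
  have "x [^] (1::int) \<otimes> g = g \<otimes> x" using comm[of x] by (simp add: twist_props q)
  then obtain r where r: "r \<in> dyadic" "g = xpow r"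
    using odd_x_power_conj[OF g(1), of 1] by auto
  have "iota 0 1 \<otimes> iota r 0 = iota r 0 \<otimes> iota 0 1"
    using comm[of y] r by (simp add: twist_props q)
  then have "iota (r / 2) 1 = iota r 1"
    using r by (simp only: iota_mult dyadic_0) simp
  then have "r / 2 = r"
    by (rule iota_inj(1)) (use r dyadic_divide_powi[of r 1] in auto)
  then have "g = \<one>" using r by simp
  then have "iota q 0 = iota 0 0" using comm[of t] by (simp add: twist_props q)
  then show "q = 0" by (rule iota_inj(1)) (simp_all add: q)
qed

text \<open>The source of surjectivity onto the outer classes. The conjugating element is a product:
  its first factor brings the images of \<open>x\<close> and \<open>y\<close> into the vertex group,
  and the others normalise them there.\<close>

lemma auto_conj_twist:
  assumes \<phi>: "\<phi> \<in> auto G"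
  obtains u q where "u \<in> carrier G" "q \<in> dyadic"
    "\<And>g. g \<in> carrier G \<Longrightarrow> conj_by G (\<phi> g) u = twist q g"
proof -
  have hom: "\<phi> \<in> hom G G" and inj: "inj_on \<phi> (carrier G)"
    using \<phi> by (auto simp: auto_def Bij_def bij_betw_def)
  interpret \<phi>: group_hom G G \<phi> using hom by unfold_locales
  define \<psi> where "\<psi> u g = conj_by G (\<phi> g) u" for u g
  have \<psi>_hom: "\<psi> u \<in> hom G G" if "u \<in> carrier G" for u
    using Group.hom_compose[OF hom conj_by_hom[OF that]] by (simp add: \<psi>_def[abs_def] comp_def)
  have \<psi>_closed: "\<psi> u g \<in> carrier G" if "u \<in> carrier G" "g \<in> carrier G" for u g
    using hom_in_carrier[OF \<psi>_hom] that by blast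
  have \<psi>_mult: "\<psi> u (g \<otimes> h) = \<psi> u g \<otimes> \<psi> u h" if "u \<in> carrier G" "g \<in> carrier G" "h \<in> carrier G" for u g h
    using hom_mult[OF \<psi>_hom] that by blast
  have \<psi>_conj: "\<psi> (u \<otimes> v) g = conj_by G (\<psi> u g) v"
    if "u \<in> carrier G" "v \<in> carrier G" "g \<in> carrier G" for u v g
    using that by (simp add: \<psi>_def conj_by_mult)

  have rel: "\<phi> x \<otimes> \<phi> y = \<phi> y \<otimes> (\<phi> x \<otimes> \<phi> x)" "\<phi> x \<otimes> \<phi> t = \<phi> t \<otimes> \<phi> y"
    using xy xt by (simp_all flip: \<phi>.hom_mult)
  obtain u where u: "u \<in> carrier G" and fix_x: "vact (\<psi> u x) [] = []" and fix_y: "vact (\<psi> u y) [] = []"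
  proof (rule tree.square_conj_common_fixed_point[of "\<phi> x" "\<phi> y" "\<phi> t"])
    show "inv \<phi> y \<otimes> \<phi> x \<otimes> \<phi> y = \<phi> x \<otimes> \<phi> x" by (simp add: m_assoc rel)
    show "\<phi> y = inv \<phi> t \<otimes> \<phi> x \<otimes> \<phi> t" by (simp add: m_assoc rel)
  qed (auto simp: \<psi>_def conj_by_def)
  obtain a k where a: "a \<in> dyadic" and \<psi>x: "\<psi> u x = iota a k"
    using stabilizer_root[OF \<psi>_closed fix_x] u by auto
  obtain b l where b: "b \<in> dyadic" and \<psi>y: "\<psi> u y = iota b l"
    using stabilizer_root[OF \<psi>_closed fix_y] u by auto
  \<comment> \<open>The image of the first relation inside the vertex group: the exponents of
    \<open>y\<close> force \<open>k = 0\<close>, those of \<open>x\<close> force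
    \<open>a * 2^l = 2 * a\<close>.\<close>
  have "iota a k \<otimes> iota b l = iota b l \<otimes> (iota a k \<otimes> iota a k)"
    using arg_cong[OF xy, of "\<psi> u"] u by (simp add: \<psi>_mult \<psi>x \<psi>y)
  then have eq: "iota (a + b / 2 powi k) (k + l) = iota (b + (a + a / 2 powi k) / 2 powi l) (l + (k + k))"
    using a b by (simp add: iota_mult dyadic_add dyadic_divide_powi)
  have "k + l = l + (k + k)" by (rule iota_inj(2)[OF eq]) (simp_all add: a b dyadic_add dyadic_divide_powi)
  then have k: "k = 0" by simp
  have "a + b / 2 powi k = b + (a + a / 2 powi k) / 2 powi l"
    by (rule iota_inj(1)[OF eq]) (simp_all add: a b dyadic_add dyadic_divide_powi)
  then have al: "a * 2 powi l = 2 * a" by (simp add: k field_simps)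
  \<comment> \<open>Otherwise \<open>\<phi>\<close> would send \<open>x\<close> to
    \<open>\<one>\<close>, against injectivity.\<close>
  have "a \<noteq> 0"
  proof
    assume "a = 0"
    then have one: "conj_by G (\<phi> x) u = \<one>" using \<psi>x k by (simp add: \<psi>_def)
    have "\<phi> x = u \<otimes> conj_by G (\<phi> x) u \<otimes> inv u"
      using u by (simp add: conj_by_def m_assoc)
    then have "\<phi> x = \<phi> \<one>" using u by (simp add: one)
    then have "x = \<one>" by (rule inj_onD[OF inj]) simp_all
    have "iota 1 0 = x" by simp
    also note \<open>x = \<one>\<close>
    also have "\<one> = iota 0 0" by simp
    finally have "iota 1 0 = iota 0 0" .
    then have "(1 :: rat) = 0" by (rule iota_inj(1)) simp_all
    then show False by simp
  qed
  then have "(2 :: rat) powi (l - 1) = 1" using al by (simp add: power_int_diff)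
  then have l: "l = 1" by (simp only: two_powi_eq_1)
  obtain j m where m: "odd m" "a * 2 powi j = of_int m"
    using dyadic_odd_multiple[OF a \<open>a \<noteq> 0\<close>] by blast
  \<comment> \<open>Conjugation by \<open>x^(2 b)\<close> turns \<open>x^b y\<close> into
    \<open>y\<close> and fixes \<open>x^a\<close>; conjugation by \<open>y^j\<close> then fixes
    \<open>y\<close> and multiplies \<open>a\<close> by \<open>2^j\<close>, which makes it the odd
    integer \<open>m\<close>.\<close>
  define v where "v = u \<otimes> iota (2 * b) 0 \<otimes> iota 0 j"
  have v: "v \<in> carrier G" by (simp only: v_def u iota_closed m_closed)
  have b2: "2 * b \<in> dyadic" using dyadic_add[OF b b] by simp
  have v_conj: "\<psi> v g = conj_by G (conj_by G (\<psi> u g) (iota (2 * b) 0)) (iota 0 j)"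
    if "g \<in> carrier G" for g
    using that u by (simp only: v_def \<psi>_conj iota_closed m_closed)
  have "conj_by G (iota b 1) (iota (2 * b) 0) = iota 0 1"
    by (rule conj_by_eqI) (simp_all only: iota_mult b b2 dyadic_0 iota_closed, simp)
  moreover have "conj_by G (iota 0 1) (iota 0 j) = iota 0 1"
    by (rule conj_by_eqI) (simp_all only: iota_mult dyadic_0 iota_closed, simp add: add.commute)
  ultimately have vy: "\<psi> v y = y" using v_conj[OF y] by (simp add: \<psi>y l)
  have "conj_by G (iota a 0) (iota (2 * b) 0) = iota a 0"
    by (rule conj_by_eqI) (simp_all only: iota_mult a b2 iota_closed, simp add: add.commute)
  moreover have "conj_by G (iota a 0) (iota 0 j) = iota (of_int m) 0"
    by (rule conj_by_eqI) (simp_all only: iota_mult a dyadic_0 dyadic_of_int iota_closed, simp flip: m(2))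
  ultimately have vx: "\<psi> v x = x [^] m" using v_conj[OF x] by (simp add: \<psi>x k)

  \<comment> \<open>By \<open>x t = t y\<close>, the factor \<open>c\<close> conjugates
    \<open>x^m\<close> to \<open>x\<close>, so that \<open>odd_x_power_conj\<close> applies.\<close>
  define c where "c = \<psi> v t \<otimes> inv t"
  have c: "c \<in> carrier G" using v by (simp add: c_def \<psi>_closed)
  have vt: "\<psi> v t = c \<otimes> t" using v by (simp add: c_def m_assoc \<psi>_closed)
  have "x [^] m \<otimes> (c \<otimes> t) = c \<otimes> t \<otimes> y"
    using arg_cong[OF xt, of "\<psi> v"] v by (simp add: \<psi>_mult vx vy vt)
  then have "(x [^] m \<otimes> c) \<otimes> t = (c \<otimes> x) \<otimes> t" using c by (simp add: m_assoc xt)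
  then have "x [^] m \<otimes> c = c \<otimes> x" using c by simp
  then obtain q where q: "q \<in> dyadic" "c = xpow q" and "m = 1"
    using odd_x_power_conj[OF c m(1)] by blast
  have "\<psi> v g = twist q g" if "g \<in> carrier G" for g
    using that by (rule hom_eqI[OF \<psi>_hom[OF v] twist_props(1)[OF q(1)], rotated 3])
      (simp_all add: vx vy vt twist_props q \<open>m = 1\<close>)
  then show thesis using that[OF v q(1)] by (simp add: \<psi>_def)
qed

lemma auto_in_twist_coset:
  assumes \<phi>: "\<phi> \<in> auto G"
  shows "\<exists>q\<in>dyadic. \<phi> \<in> Inn G #>\<^bsub>AutoGroup G\<^esub> twist q"
proof -
  obtain u q where u: "u \<in> carrier G" and q: "q \<in> dyadic"
    and eq: "\<And>g. g \<in> carrier G \<Longrightarrow> conj_by G (\<phi> g) u = twist q g"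
    using auto_conj_twist[OF \<phi>] by blast
  interpret A: group "AutoGroup G" by (rule AutoGroup)
  define i where "i = (\<lambda>a\<in>carrier G. conj_by G a (inv u))"
  have i: "i \<in> Inn G" using u by (auto simp: Inn_def i_def)
  then have i_auto: "i \<in> auto G"
    using normal_imp_subgroup[OF Inn_normal] subgroup.subset carrier_AutoGroup by blast
  have \<phi>_closed: "\<phi> g \<in> carrier G" if "g \<in> carrier G" for g
    using \<phi> that by (auto simp: auto_def dest: hom_in_carrier)
  have comp: "i \<otimes>\<^bsub>AutoGroup G\<^esub> twist q = compose (carrier G) i (twist q)"
    using i_auto q by (intro mult_AutoGroup twist_auto)
  have "\<phi> = i \<otimes>\<^bsub>AutoGroup G\<^esub> twist q"
  proof
    fix g
    show "\<phi> g = (i \<otimes>\<^bsub>AutoGroup G\<^esub> twist q) g"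
    proof (cases "g \<in> carrier G")
      case True
      then have "i (twist q g) = conj_by G (conj_by G (\<phi> g) u) (inv u)"
        using u q by (simp add: i_def eq twist_closed)
      also have "\<dots> = \<phi> g"
        using u \<phi>_closed[OF True] by (simp add: conj_by_def m_assoc)
      finally show ?thesis using True by (simp add: comp compose_eq)
    next
      case False
      then show ?thesis using \<phi> by (simp add: comp compose_def auto_def Bij_def extensional_def)
    qed
  qed
  then show ?thesis using i q by (auto simp: r_coset_def)
qed

end

section \<open>The dyadic group and its isomorphism with \<open>Out G\<close>\<close>

lemma carrier_dyadic_group: "carrier dyadic_group = dyadic"
proof -
  interpret R: group rat_group by (rule group_rat_group)
  have rat: "carrier rat_group = UNIV" "a \<otimes>\<^bsub>rat_group\<^esub> b = a + b" "\<one>\<^bsub>rat_group\<^esub> = 0" for a b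
    by (simp_all add: rat_group_def)
  have inv: "inv\<^bsub>rat_group\<^esub> q = - q" for q
    by (rule R.inv_equality) (simp_all add: rat)
  let ?S = "{1 / 2 ^ i | i :: nat. i \<ge> 1} :: rat set"
  have sub: "subgroup dyadic rat_group"
  proof (rule R.subgroupI)
    show "dyadic \<noteq> {}" using dyadic_0 by blast
  qed (auto simp: inv rat intro: dyadic_minus dyadic_add)
  have "generate rat_group ?S \<subseteq> dyadic"
    by (rule R.generate_subgroup_incl[OF _ sub]) (auto intro: dyadicI[of _ 1])
  moreover have "dyadic \<subseteq> generate rat_group ?S"
  proof
    fix q assume "q \<in> dyadic"
    then obtain m i where q: "q = of_int m / 2 ^ i" by (elim dyadicE)
    \<comment> \<open>The generators start at exponent 1, so \<open>q\<close> is written with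
      denominator \<open>2^(i + 1)\<close> and numerator \<open>2 * m\<close>; this covers
      \<open>i = 0\<close>.\<close>
    have "1 / 2 ^ Suc i \<in> generate rat_group ?S" 
      by (intro generate.incl CollectI exI[of _ "Suc i"]) simp
    then have "(1 / 2 ^ Suc i) [^]\<^bsub>rat_group\<^esub> (2 * m) \<in> generate rat_group ?S"
      by (intro R.subgroup_int_pow_closed R.generate_is_subgroup) (simp_all add: rat)
    moreover have "r [^]\<^bsub>rat_group\<^esub> n = of_int n * r" for r and n :: int
    proof -
      have "r [^]\<^bsub>rat_group\<^esub> n = of_nat n * r" for n :: nat
        by (induction n) (simp_all add: rat algebra_simps)
      then show ?thesis by (cases n) (auto simp: int_pow_def2 inv algebra_simps)
    qed
    ultimately show "q \<in> generate rat_group ?S" by (simp add: q)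
  qed
  ultimately show ?thesis by (simp add: dyadic_group_def carrier_subgroup_generated rat)
qed

lemma mult_dyadic_group [simp]: "a \<otimes>\<^bsub>dyadic_group\<^esub> b = a + b"
  by (simp add: dyadic_group_def subgroup_generated_def rat_group_def)

lemma one_dyadic_group [simp]: "\<one>\<^bsub>dyadic_group\<^esub> = 0"
  by (simp add: dyadic_group_def subgroup_generated_def rat_group_def)

lemma group_dyadic_group: "group dyadic_group"
  unfolding dyadic_group_def by (rule group.group_subgroup_generated[OF group_rat_group])

text \<open>Twists add up by \<open>twist_mult\<close>; \<open>twist_inner\<close> gives injectivity
  and \<open>auto_in_twist_coset\<close> surjectivity.\<close>

lemma (in bg_group) dyadic_iso_Out:
  "(\<lambda>q. Inn G #>\<^bsub>AutoGroup G\<^esub> twist q) \<in> iso dyadic_group (Out G)"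
proof -
  interpret A: group "AutoGroup G" by (rule AutoGroup)
  interpret N: normal "Inn G" "AutoGroup G" by (rule Inn_normal)
  let ?F = "\<lambda>q. Inn G #>\<^bsub>AutoGroup G\<^esub> twist q"
  have "twist \<in> hom dyadic_group (AutoGroup G)"
    by (rule homI) (simp_all add: carrier_dyadic_group carrier_AutoGroup twist_auto twist_mult)
  from Group.hom_compose[OF this N.r_coset_hom_Mod]
  have hom: "?F \<in> hom dyadic_group (Out G)" by (simp add: comp_def Out_def)
  interpret F: group_hom dyadic_group "Out G" ?F
    using hom by (simp add: group_hom_def group_hom_axioms_def group_dyadic_group group_Out)
  have "inj_on ?F (carrier dyadic_group)"
    unfolding F.inj_on_one_iff
  proof (intro allI impI)
    fix q assume q: "q \<in> carrier dyadic_group" "?F q = \<one>\<^bsub>Out G\<^esub>"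
    then have "twist q \<in> ?F q"
      by (intro A.rcos_self N.subgroup_axioms) (simp add: carrier_dyadic_group carrier_AutoGroup twist_auto)
    then have "twist q \<in> Inn G" using q(2) by (simp add: Out_def FactGroup_def)
    then show "q = \<one>\<^bsub>dyadic_group\<^esub>" using q(1) twist_inner by (simp add: carrier_dyadic_group)
  qed
  moreover have "carrier (Out G) \<subseteq> ?F ` carrier dyadic_group"
  proof
    fix C assume "C \<in> carrier (Out G)"
    then obtain \<phi> where \<phi>: "\<phi> \<in> auto G" "C = Inn G #>\<^bsub>AutoGroup G\<^esub> \<phi>"
      by (auto simp: Out_def FactGroup_def RCOSETS_def carrier_AutoGroup)
    obtain q where q: "q \<in> dyadic" "\<phi> \<in> ?F q" using auto_in_twist_coset[OF \<phi>(1)] by blast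
    have "?F q = C" unfolding \<phi>(2)
      by (rule A.repr_independence[OF q(2)]) (simp_all add: q carrier_AutoGroup twist_auto N.subgroup_axioms)
    then show "C \<in> ?F ` carrier dyadic_group" using q(1) by (auto simp: carrier_dyadic_group)
  qed
  ultimately show ?thesis using hom F.hom_closed by (auto simp: iso_iff)
qed

section \<open>Realisation by the presented group\<close>

definition bg_relations :: "(bg_gen free \<times> bg_gen free) set" where
  "bg_relations =
    {(conj_by free_group (free_gen GX) (free_gen GY), free_gen GX [^]\<^bsub>free_group\<^esub> (2::nat)),
     (conj_by free_group (free_gen GX) (free_gen GT), free_gen GY)}"

lemma baumslag_gersten_alt: "baumslag_gersten = presented_group bg_relations"
  by (simp add: baumslag_gersten_def bg_relations_def)

text \<open>Serves twice: with the group itself as \<open>K\<close> it yields endomorphisms, with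
  the permutations of the reduced words it yields the action on the tree.\<close>

lemma bg_hom_exists:
  assumes K: "group K" and abc: "a \<in> carrier K" "b \<in> carrier K" "c \<in> carrier K"
    and ab: "a \<otimes>\<^bsub>K\<^esub> b = b \<otimes>\<^bsub>K\<^esub> (a \<otimes>\<^bsub>K\<^esub> a)" and ac: "a \<otimes>\<^bsub>K\<^esub> c = c \<otimes>\<^bsub>K\<^esub> b"
  shows "\<exists>\<phi>\<in>hom baumslag_gersten K. \<phi> (quot_map bg_relations (free_gen GX)) = a
    \<and> \<phi> (quot_map bg_relations (free_gen GY)) = b \<and> \<phi> (quot_map bg_relations (free_gen GT)) = c"
proof -
  interpret K: group K by (rule K)
  define f where "f = case_bg_gen a b c"
  have f: "range f \<subseteq> carrier K" using abc by (auto simp: f_def split: bg_gen.split)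
  interpret e: group_hom free_group K "free_eval K f"
    using K.free_eval_hom[OF f] by (simp add: group_hom_def group_hom_axioms_def group_free_group K)
  have conj: "free_eval K f (conj_by free_group u v) = conj_by K (free_eval K f u) (free_eval K f v)" for u v
    by (simp add: conj_by_def)
  have vals: "free_eval K f (free_gen GX) = a" "free_eval K f (free_gen GY) = b" "free_eval K f (free_gen GT) = c"
    unfolding K.free_eval_gen[OF f] by (simp_all add: f_def)
  have rels: "free_eval K f u = free_eval K f v" if "(u, v) \<in> bg_relations" for u v
    using that abc
    by (auto simp: bg_relations_def conj vals numeral_2_eq_2 ab ac intro!: K.conj_by_eqI)
  obtain \<phi> where \<phi>: "\<phi> \<in> hom (presented_group bg_relations) K" "\<And>g. \<phi> (quot_map bg_relations (free_gen g)) = f g"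
    using presented_group_universal[OF K f rels] by blast
  from \<phi>(1) show ?thesis unfolding baumslag_gersten_alt by (intro bexI[of _ \<phi>]) (simp_all add: \<phi>(2) f_def)
qed

lemma bg_group_baumslag_gersten: "\<exists>x y t vact. bg_group baumslag_gersten x y t vact"
proof -
  define x y t where "x = quot_map bg_relations (free_gen GX)" "y = quot_map bg_relations (free_gen GY)"
    "t = quot_map bg_relations (free_gen GT)"
  note hom_exists = bg_hom_exists[folded x_y_t_def]
  interpret G: group baumslag_gersten unfolding baumslag_gersten_alt by (rule group_presented_group)
  interpret q: group_hom free_group baumslag_gersten "quot_map bg_relations"
    using quot_map_hom[of bg_relations] by (simp add: group_hom_def group_hom_axioms_def group_free_group group_presented_group baumslag_gersten_alt)
  have closed: "x \<in> carrier baumslag_gersten" "y \<in> carrier baumslag_gersten" "t \<in> carrier baumslag_gersten"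
    using q.hom_closed by (auto simp: x_y_t_def)
  have conj: "quot_map bg_relations (conj_by free_group u v) = conj_by baumslag_gersten (quot_map bg_relations u) (quot_map bg_relations v)" for u v
    by (simp add: conj_by_def)
  have r1: "(conj_by free_group (free_gen GX) (free_gen GY), free_gen GX [^]\<^bsub>free_group\<^esub> (2::nat)) \<in> bg_relations"
    and r2: "(conj_by free_group (free_gen GX) (free_gen GT), free_gen GY) \<in> bg_relations"
    by (simp_all add: bg_relations_def)
  have "conj_by baumslag_gersten x y = x \<otimes>\<^bsub>baumslag_gersten\<^esub> x"
    using quot_map_rel[OF r1] by (simp add: conj x_y_t_def numeral_2_eq_2)
  moreover have "conj_by baumslag_gersten x t = y"
    using quot_map_rel[OF r2] by (simp add: conj x_y_t_def)
  ultimately have rel: "x \<otimes>\<^bsub>baumslag_gersten\<^esub> y = y \<otimes>\<^bsub>baumslag_gersten\<^esub> (x \<otimes>\<^bsub>baumslag_gersten\<^esub> x)"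
    "x \<otimes>\<^bsub>baumslag_gersten\<^esub> t = t \<otimes>\<^bsub>baumslag_gersten\<^esub> y"
    using G.mult_conj_by[of y x] G.mult_conj_by[of t x] closed by simp_all
  have UNIV_bg_gen: "UNIV = {GX, GY, GT}" using bg_gen.exhaust by auto
  have "range (\<lambda>a. quot_map bg_relations (free_gen a)) = {x, y, t}"
    unfolding UNIV_bg_gen by (simp add: x_y_t_def)
  then have gen: "generate baumslag_gersten {x, y, t} = carrier baumslag_gersten"
    using presented_group_generate[of bg_relations] by (simp add: baumslag_gersten_alt)

  define V where "V = {w. reduced w}"
  let ?B = "BijGroup V"
  interpret B: group ?B by (rule group_BijGroup)
  have Bij: "restrict f V \<in> Bij V"
    if "\<And>w. reduced w \<Longrightarrow> reduced (f w) \<and> reduced (h w) \<and> h (f w) = w \<and> f (h w) = w" for f h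
  proof -
    have "bij_betw f V V"
      by (rule bij_betw_byWitness[where f' = h]) (use that in \<open>auto simp: V_def\<close>)
    then show ?thesis by (simp add: Bij_def)
  qed
  \<comment> \<open>The permutations by which the generators are to act, restricted to
    \<open>V\<close> because elements of \<open>BijGroup V\<close> are extensional.\<close>
  define a b c where "a = restrict (hact 1 0) V" "b = restrict (hact 0 1) V" "c = restrict tpush V"
  have abc: "a \<in> Bij V" "b \<in> Bij V" "c \<in> Bij V"
    unfolding a_b_c_def
    by (rule Bij[of _ "hact (- 1) 0"] Bij[of _ "hact 0 (- 1)"] Bij[of _ tpop],
        simp add: hact_reduced hact_hact hact_zero dyadic_minus tpush_reduced tpop_reduced tpop_tpush tpush_tpop)+
  have mult: "f \<otimes>\<^bsub>?B\<^esub> h = compose V f h" if "f \<in> Bij V" "h \<in> Bij V" for f h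
    using that by (simp add: BijGroup_def)
  have carrB: "carrier ?B = Bij V" by (simp add: BijGroup_def)
  have "a \<otimes>\<^bsub>?B\<^esub> b = b \<otimes>\<^bsub>?B\<^esub> (a \<otimes>\<^bsub>?B\<^esub> a)"
    by (simp add: mult abc compose_Bij) (auto simp: compose_def fun_eq_iff a_b_c_def V_def hact_reduced hact_hact)
  moreover have "a \<otimes>\<^bsub>?B\<^esub> c = c \<otimes>\<^bsub>?B\<^esub> b"
    by (simp add: mult abc) (auto simp: compose_def fun_eq_iff a_b_c_def V_def hact_reduced tpush_reduced hact_tpush)
  ultimately obtain \<alpha> where \<alpha>: "\<alpha> \<in> hom baumslag_gersten ?B" "\<alpha> x = a" "\<alpha> y = b" "\<alpha> t = c"
    using hom_exists[OF B.group_axioms, of a b c] abc by (auto simp: carrB)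
  interpret \<alpha>: group_hom baumslag_gersten ?B \<alpha> using \<alpha>(1) by unfold_locales
  have \<alpha>_Bij: "\<alpha> g \<in> Bij V" if "g \<in> carrier baumslag_gersten" for g
    using \<alpha>.hom_closed[OF that] by (simp add: carrB)
  have "bg_group baumslag_gersten x y t \<alpha>"
  proof
    fix g w assume "g \<in> carrier baumslag_gersten" "reduced w"
    then show "reduced (\<alpha> g w)" using Bij_imp_funcset[OF \<alpha>_Bij] by (auto simp: V_def Pi_def)
  next
    fix w assume "reduced w"
    then show "\<alpha> \<one>\<^bsub>baumslag_gersten\<^esub> w = w" by (simp add: BijGroup_def V_def)
  next
    fix g h w assume "g \<in> carrier baumslag_gersten" "h \<in> carrier baumslag_gersten" "reduced w"
    moreover from this have "w \<in> V" by (simp add: V_def)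
    ultimately show "\<alpha> (g \<otimes>\<^bsub>baumslag_gersten\<^esub> h) w = \<alpha> g (\<alpha> h w)"
      by (simp add: mult \<alpha>_Bij compose_def)
  next
    fix a b c
    assume "a \<in> carrier baumslag_gersten" "b \<in> carrier baumslag_gersten" "c \<in> carrier baumslag_gersten"
      "a \<otimes>\<^bsub>baumslag_gersten\<^esub> b = b \<otimes>\<^bsub>baumslag_gersten\<^esub> (a \<otimes>\<^bsub>baumslag_gersten\<^esub> a)"
      "a \<otimes>\<^bsub>baumslag_gersten\<^esub> c = c \<otimes>\<^bsub>baumslag_gersten\<^esub> b"
    then show "\<exists>\<phi>\<in>hom baumslag_gersten baumslag_gersten. \<phi> x = a \<and> \<phi> y = b \<and> \<phi> t = c"
      by (rule hom_exists[OF G.group_axioms])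
  qed (simp_all add: closed rel gen \<alpha> a_b_c_def V_def)
  then show ?thesis by blast
qed

section \<open>Finite generation\<close>

lemma finitely_generated_iso:
  assumes "group G" "group H" "h \<in> iso G H" "finitely_generated G"
  shows "finitely_generated H"
proof -
  interpret h: group_hom G H h
    using assms by (simp add: group_hom_def group_hom_axioms_def iso_def)
  obtain S where S: "finite S" "S \<subseteq> carrier G" "generate G S = carrier G"
    using assms(4) by (auto simp: finitely_generated_def)
  have "generate H (h ` S) = carrier H"
    using h.generate_img[OF S(2)] S(3) assms(3) by (simp add: iso_iff)
  moreover have "h ` S \<subseteq> carrier H" using S(2) by auto
  ultimately show ?thesis using S(1) by (auto simp: finitely_generated_def)
qed

text \<open>Finitely many dyadic rationals have a common denominator \<open>2^i\<close>, which then
  serves for everything they generate, but not for \<open>1 / 2^(i + 1)\<close>.\<close>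

lemma dyadic_group_not_finitely_generated: "\<not> finitely_generated dyadic_group"
proof
  interpret D: group dyadic_group by (rule group_dyadic_group)
  assume "finitely_generated dyadic_group"
  then obtain S where S: "finite S" "S \<subseteq> dyadic" "generate dyadic_group S = dyadic"
    by (auto simp: finitely_generated_def carrier_dyadic_group)
  from S(1,2) have "\<exists>i. \<forall>s\<in>S. s * 2 ^ i \<in> \<int>"
  proof (induction rule: finite_induct)
    case (insert s S)
    then obtain i where i: "\<forall>s\<in>S. s * 2 ^ i \<in> \<int>" by auto
    obtain m j where s: "s = of_int m / 2 ^ j" using insert.prems by (auto elim: dyadicE)
    have "r * 2 ^ (i + j) \<in> \<int>" if "r \<in> S" for r
    proof -
      have "r * 2 ^ (i + j) = r * 2 ^ i * of_int (2 ^ j)" by (simp add: power_add)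
      then show ?thesis using i that by (metis Ints_mult Ints_of_int)
    qed
    moreover have "s * 2 ^ (i + j) = of_int (m * 2 ^ i)" by (simp add: s power_add)
    then have "s * 2 ^ (i + j) \<in> \<int>" by (metis Ints_of_int)
    ultimately show ?case by (intro exI[of _ "i + j"]) auto
  qed simp
  then obtain i where i: "\<And>s. s \<in> S \<Longrightarrow> s * 2 ^ i \<in> \<int>" by blast
  have inv: "inv\<^bsub>dyadic_group\<^esub> q = - q" if "q \<in> dyadic" for q
    using that by (intro D.inv_equality) (simp_all add: carrier_dyadic_group dyadic_minus)
  have "q * 2 ^ i \<in> \<int>" if "q \<in> generate dyadic_group S" for q
    using that
  proof induction
    case (inv h)
    then have "h \<in> dyadic" using S(2) by blast
    then show ?case using i[OF inv.hyps] by (simp add: \<open>\<And>q. q \<in> dyadic \<Longrightarrow> inv\<^bsub>dyadic_group\<^esub> q = - q\<close>)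
  qed (use i in \<open>auto simp: algebra_simps\<close>)
  moreover have "1 / 2 ^ Suc i \<in> generate dyadic_group S"
    unfolding S(3) by (rule dyadicI[of _ 1 "Suc i"]) simp
  ultimately have "1 / 2 ^ Suc i * 2 ^ i \<in> (\<int> :: rat set)" by blast
  then obtain n where "(1 / 2 :: rat) = of_int n" by (auto elim: Ints_cases)
  then have "of_int (2 * n) = (of_int 1 :: rat)" by simp
  then have "2 * n = 1" by (simp only: of_int_eq_iff)
  then show False by presburger
qed

theorem theorem1p1:
  shows "Out baumslag_gersten \<cong> dyadic_group
    \<and> \<not> finitely_generated (Out baumslag_gersten)
    \<and> \<not> finitely_generated dyadic_group"
proof -
  obtain x y t vact where "bg_group baumslag_gersten x y t vact"
    using bg_group_baumslag_gersten by blast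
  then interpret bg_group baumslag_gersten x y t vact .
  have iso: "Out baumslag_gersten \<cong> dyadic_group"
    using group.iso_sym[OF group_dyadic_group is_isoI[OF dyadic_iso_Out]] .
  then obtain h where "h \<in> iso (Out baumslag_gersten) dyadic_group"
    by (auto simp: is_iso_def)
  then have "\<not> finitely_generated (Out baumslag_gersten)"
    using finitely_generated_iso[OF group_Out group_dyadic_group] dyadic_group_not_finitely_generated by blast
  with iso dyadic_group_not_finitely_generated show ?thesis by blast
qed

end
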